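(* Let $\mathcal{A} \subseteq \mathbb{R}$ be a compact set and $\mu_0$ a Borel probability measure with topological support $\operatorname{supp}\mu_0 = \mathcal{A}$. Let $\Omega=\mathcal{A}^{\mathbb{Z}}$, $\mu=\mu_0^{\mathbb{Z}}$, and let $T:\Omega\to\Omega$ be the shift $[T\omega]_n = \omega_{n+1}$. Then the Schwartzman group of $(\Omega,T,\mu)$ is $$\mathfrak{S}(\Omega,T,\mu) = \mathbb{Z}[\mu_0(\mathrm{clop}(\mathcal{A}))].$$
   Context: Clopen sets: for a topological space $Y$, $\mathrm{clop}(Y)$ is the collection of subsets of $Y$ that are both closed and open; $\mathcal{A}$ carries the relative topology inherited from $\mathbb{R}$ and $\Omega=\mathcal{A}^{\mathbb{Z}}$ the product topology. For a measure $\nu$ and a collection $\mathcal{P}$ of measurable sets, $\nu(\mathcal{P})=\{\nu(P):P\in\mathcal{P}\}$. For $W\subseteq\mathbb{R}$, $\mathbb{Z}[W]$ denotes the algebra (over $\mathbb{Z}$, inside $\mathbb{R}$) generated by $W$, i.e. the smallest one containing $W$. Schwartzman group: Let $\Omega$ be a compact metric space, $T:\Omega\to\Omega$ a homeomorphism and $\mu$ a $T$-ergodic Borel probability measure. The suspension $(X,\tau,\nu)$ is given by $X=(\Omega\times\mathbb{R})/\!\sim$ with $(T^n\omega,t)\sim(\omega,t+n)$ for $\omega\in\Omega$, $t\in\mathbb{R}$, $n\in\mathbb{Z}$, the flow $\tau^s([\omega,t])=[\omega,s+t]$, and the measure $\int_X f\,d\nu=\int_\Omega\int_0^1 f([\omega,t])\,dt\,d\mu(\omega)$.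 Let $\mathbb{T}=\mathbb{R}/\mathbb{Z}$. Given continuous $\phi:X\to\mathbb{T}$ and $x\in X$, let $\widetilde\phi_x:\mathbb{R}\to\mathbb{R}$ be a continuous lift of $\phi_x(t)=\phi(\tau^t x)$, i.e. $\widetilde\phi_x \bmod \mathbb{Z}=\phi_x$. The limit $\lim_{t\to\infty}\widetilde\phi_x(t)/t$ exists for $\nu$-a.e. $x$, is $\nu$-a.e. constant, and depends only on the homotopy class of $\phi$. Denote by $C^\sharp(X,\mathbb{T})$ the set of homotopy classes of continuous maps $X\to\mathbb{T}$ and by $\mathfrak{A}_\nu:C^\sharp(X,\mathbb{T})\to\mathbb{R}$ the induced map (the Schwartzman homomorphism). The Schwartzman group is $\mathfrak{S}(\Omega,T,\mu)=\mathfrak{A}_\nu(C^\sharp(X,\mathbb{T}))$. *)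

theory Defs
  imports "HOL-Probability.Probability"
begin

section \<open>Quotient spaces and homotopy classes\<close>

definition quotient_topology :: "'a topology \<Rightarrow> ('a \<times> 'a) set \<Rightarrow> 'a set topology" where
  "quotient_topology X R = topology (\<lambda>U. U \<subseteq> topspace X // R \<and>
     openin X {x \<in> topspace X. R `` {x} \<in> U})"

lemma istopology_quotient:
  "istopology (\<lambda>U. U \<subseteq> topspace X // R \<and> openin X {x \<in> topspace X. R `` {x} \<in> U})"
proof -
  have inter: "{x \<in> topspace X. R `` {x} \<in> S \<inter> S'} =
      {x \<in> topspace X. R `` {x} \<in> S} \<inter> {x \<in> topspace X. R `` {x} \<in> S'}" for S S'
    by auto
  have union: "{x \<in> topspace X. R `` {x} \<in> \<Union>K} = (\<Union>S\<in>K. {x \<in> topspace X. R `` {x} \<in> S})" for K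
    by auto
  show ?thesis
    unfolding istopology_def inter union by (auto intro!: openin_Int openin_clauses(3))
qed

lemma openin_quotient_topology:
  "openin (quotient_topology X R) U \<longleftrightarrow>
     U \<subseteq> topspace X // R \<and> openin X {x \<in> topspace X. R `` {x} \<in> U}"
  unfolding quotient_topology_def topology_inverse'[OF istopology_quotient] ..

lemma topspace_quotient_topology: "topspace (quotient_topology X R) = topspace X // R"
proof -
  have "{x \<in> topspace X. R `` {x} \<in> topspace X // R} = topspace X"
    by (auto intro: quotientI)
  then have "openin (quotient_topology X R) (topspace X // R)"
    by (simp add: openin_quotient_topology)
  then show ?thesis
    by (meson openin_quotient_topology openin_subset openin_topspace subset_antisym)
qed

definition circle_rel :: "(real \<times> real) set" where
  "circle_rel = {(s, t). s - t \<in> \<int>}"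

definition circle :: "real set topology" where
  "circle = quotient_topology euclideanreal circle_rel"

definition homotopy_classes :: "'a topology \<Rightarrow> 'b topology \<Rightarrow> ('a \<Rightarrow> 'b) set set" where
  "homotopy_classes X Y =
     {f. continuous_map X Y f} // {(f, g). homotopic_with (\<lambda>_. True) X Y f g}"


section \<open>Suspensions and the Schwartzman group\<close>

text \<open>
  In this section \<open>\<Omega>\<close> is meant to be a compact metrizable space, \<open>T\<close> a homeomorphism of
  \<open>\<Omega>\<close> onto itself, and \<open>\<mu>\<close> a \<open>T\<close>-ergodic probability measure on the Borel sets of \<open>\<Omega>\<close>.
\<close>

definition int_iterate :: "'a topology \<Rightarrow> ('a \<Rightarrow> 'a) \<Rightarrow> int \<Rightarrow> 'a \<Rightarrow> 'a" where
  "int_iterate \<Omega> T n =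
     (if 0 \<le> n then T ^^ nat n else inv_into (topspace \<Omega>) T ^^ nat (- n))"

definition suspension_rel :: "'a topology \<Rightarrow> ('a \<Rightarrow> 'a) \<Rightarrow> (('a \<times> real) \<times> ('a \<times> real)) set" where
  "suspension_rel \<Omega> T =
     {((int_iterate \<Omega> T n \<omega>, t), (\<omega>, t + of_int n)) | \<omega> t n. \<omega> \<in> topspace \<Omega>}"

definition suspension :: "'a topology \<Rightarrow> ('a \<Rightarrow> 'a) \<Rightarrow> ('a \<times> real) set topology" where
  "suspension \<Omega> T = quotient_topology (prod_topology \<Omega> euclideanreal) (suspension_rel \<Omega> T)"

definition suspension_proj :: "'a topology \<Rightarrow> ('a \<Rightarrow> 'a) \<Rightarrow> 'a \<times> real \<Rightarrow> ('a \<times> real) set" where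
  "suspension_proj \<Omega> T p = suspension_rel \<Omega> T `` {p}"

text \<open>The flow translates an equivalence class, viewed as a set of representatives, as a whole;
  see \<open>suspension_flow_proj\<close>.\<close>

definition suspension_flow :: "real \<Rightarrow> ('a \<times> real) set \<Rightarrow> ('a \<times> real) set" where
  "suspension_flow s x = (\<lambda>(\<omega>, t). (\<omega>, s + t)) ` x"

lemma suspension_flow_proj:
  "suspension_flow s (suspension_proj \<Omega> T (\<omega>, t)) = suspension_proj \<Omega> T (\<omega>, s + t)"
proof -
  have class_eq: "suspension_proj \<Omega> T (\<omega>, t) =
      {(\<omega>', t + of_int n) | \<omega>' n. \<omega>' \<in> topspace \<Omega> \<and> \<omega> = int_iterate \<Omega> T n \<omega>'}" for t
    by (auto simp: suspension_proj_def suspension_rel_def)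
  show ?thesis
    unfolding class_eq suspension_flow_def by (force simp: image_iff add.assoc)
qed

definition suspension_measure ::
    "'a topology \<Rightarrow> ('a \<Rightarrow> 'a) \<Rightarrow> 'a measure \<Rightarrow> ('a \<times> real) set measure" where
  "suspension_measure \<Omega> T \<mu> =
     distr (\<mu> \<Otimes>\<^sub>M restrict_space lborel {0..1})
       (sigma (topspace (suspension \<Omega> T)) {U. openin (suspension \<Omega> T) U})
       (suspension_proj \<Omega> T)"

definition is_lift_along_orbit ::
    "(('a \<times> real) set \<Rightarrow> real set) \<Rightarrow> ('a \<times> real) set \<Rightarrow> (real \<Rightarrow> real) \<Rightarrow> bool" where
  "is_lift_along_orbit \<phi> x f \<longleftrightarrow>
     continuous_on UNIV f \<and> (\<forall>t. circle_rel `` {f t} = \<phi> (suspension_flow t x))"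

definition schwartzman_hom ::
    "'a topology \<Rightarrow> ('a \<Rightarrow> 'a) \<Rightarrow> 'a measure \<Rightarrow> (('a \<times> real) set \<Rightarrow> real set) set \<Rightarrow> real" where
  "schwartzman_hom \<Omega> T \<mu> c =
     (THE r. \<forall>\<phi>\<in>c. AE x in suspension_measure \<Omega> T \<mu>.
        \<exists>f. is_lift_along_orbit \<phi> x f \<and> ((\<lambda>t. f t / t) \<longlongrightarrow> r) at_top)"

definition schwartzman_group :: "'a topology \<Rightarrow> ('a \<Rightarrow> 'a) \<Rightarrow> 'a measure \<Rightarrow> real set" where
  "schwartzman_group \<Omega> T \<mu> =
     schwartzman_hom \<Omega> T \<mu> ` homotopy_classes (suspension \<Omega> T) circle"


section \<open>The full shift and the gap labels\<close>

definition full_shift_space :: "real set \<Rightarrow> (int \<Rightarrow> real) topology" where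
  "full_shift_space A = product_topology (\<lambda>_. top_of_set A) UNIV"

definition full_shift :: "(int \<Rightarrow> real) \<Rightarrow> int \<Rightarrow> real" where
  "full_shift \<omega> = (\<lambda>n. \<omega> (n + 1))"

text \<open>The base measure lives on the whole line; it is restricted to the alphabet first, so that
  the product measure has \<open>A\<^sup>\<int>\<close> as its underlying space.\<close>

definition full_shift_measure :: "real set \<Rightarrow> real measure \<Rightarrow> (int \<Rightarrow> real) measure" where
  "full_shift_measure A \<mu>0 = (\<Pi>\<^sub>M n\<in>UNIV. restrict_space \<mu>0 A)"

definition topological_support :: "'a::topological_space measure \<Rightarrow> 'a set" where
  "topological_support \<mu>0 = {x. \<forall>U. open U \<and> x \<in> U \<longrightarrow> emeasure \<mu>0 U > 0}"

definition clop :: "'a topology \<Rightarrow> 'a set set" where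
  "clop Y = {C. closedin Y C \<and> openin Y C}"

definition is_subring :: "'a::ring_1 set \<Rightarrow> bool" where
  "is_subring S \<longleftrightarrow> 1 \<in> S \<and> (\<forall>x\<in>S. \<forall>y\<in>S. x - y \<in> S \<and> x * y \<in> S)"

text \<open>The \<open>\<int>\<close>-subalgebras of a ring are its subrings.\<close>

definition int_algebra :: "real set \<Rightarrow> real set" where
  "int_algebra W = is_subring hull W"

end

theory Submission
  imports Defs "HOL-Real_Asymp.Real_Asymp" "HOL-Library.Discrete_Functions"
begin

text \<open>
  Unrolled along the flow, a circle-valued map \<open>\<phi>\<close> on the suspension becomes a map \<open>\<phi>([\<omega>, t])\<close> on
  the box \<open>A\<^sup>\<int> \<times> [0, 1]\<close>. The proof rests on the fact that this map has a continuous real lift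
  \<open>H\<close> on the whole box. Since \<open>[\<omega>, 1] = [T \<omega>, 0]\<close>, the function
  \<open>k(\<omega>) = H(\<omega>, 1) - H(T \<omega>, 0)\<close> is then integer-valued and continuous, and a lift of \<open>\<phi>\<close> along the
  orbit of \<open>\<omega>\<close> stays within bounded distance of the Birkhoff sums of \<open>k\<close>. Hence the Schwartzman
  homomorphism sends the class of \<open>\<phi>\<close> to \<open>\<integral>k d\<mu>\<close>. Conversely every continuous
  \<open>k : A\<^sup>\<int> \<rightarrow> \<int>\<close> arises in this way, from \<open>\<phi>([\<omega>, t]) = t k(\<omega>)\<close> for \<open>0 \<le> t \<le> 1\<close>. So the
  Schwartzman group is the set of integrals of continuous integer-valued functions.

  Lifts exist because a compact subset of the line can be collapsed, through finitely many
  continuous self-maps each close to the next, to a map with finite range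
  (\<open>collapsible_compact_real\<close>), and this property passes to countable powers and to products. Along
  such a chain a circle-valued map changes by factors close to \<open>1\<close>, which have a logarithm, and at
  its end the map is locally constant (\<open>circle_map_has_lift\<close>). Lifting over one more factor
  \<open>[0, 1]\<close> shows that homotopic maps may be given the same \<open>k\<close> (\<open>homotopic_box_lifts\<close>).

  The same chain leaves an integer-valued continuous \<open>k\<close> unchanged. So \<open>k\<close> depends on finitely many
  coordinates, and on each of these only through the piece of a finite clopen partition of \<open>A\<close>
  containing it: \<open>k\<close> is an integer combination of products of indicators \<open>1\<^sub>C(\<omega>\<^sub>i)\<close>
  with \<open>C\<close> clopen, and its integral lies in \<open>\<int>[\<mu>\<^sub>0(clop(A))]\<close>. In the other direction the integrals
  form a ring, the product being realised by moving one of the two functions by a power of the shift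
  until they depend on disjoint sets of coordinates (\<open>is_subring_integer_means\<close>). Finite dependence
  also makes the ergodic theorem elementary: the terms of the Birkhoff sums are uncorrelated beyond a
  bounded distance, and a second-moment estimate gives almost sure convergence
  (\<open>strong_law_finite_range\<close>).
\<close>



section \<open>Collapsing a compact set by small steps\<close>

text \<open>
  A chain of maps in this relation is a discrete homotopy. It does the work of a homotopy for sets,
  such as Cantor sets, that are too disconnected to be moved continuously.
\<close>

definition near_maps :: "real \<Rightarrow> 'a::metric_space set \<Rightarrow> (('a \<Rightarrow> 'a) \<times> ('a \<Rightarrow> 'a)) set" where
  "near_maps e S = {(f, g). continuous_on S f \<and> continuous_on S g \<and> f \<in> S \<rightarrow> S \<and> g \<in> S \<rightarrow> S \<and>
     (\<forall>x\<in>S. dist (f x) (g x) < e)}"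

definition collapsible :: "'a::metric_space set \<Rightarrow> bool" where
  "collapsible S \<longleftrightarrow> (\<forall>e>0. \<exists>c. (id, c) \<in> (near_maps e S)\<^sup>* \<and> finite (c ` S))"

lemma near_maps_chain_end:
  assumes "(id, c) \<in> (near_maps e S)\<^sup>*"
  shows "continuous_on S c" "c \<in> S \<rightarrow> S"
proof -
  have "continuous_on S c \<and> c \<in> S \<rightarrow> S"
    using assms by (induction rule: rtrancl_induct) (auto simp: near_maps_def)
  then show "continuous_on S c" "c \<in> S \<rightarrow> S" by auto
qed

lemma near_maps_chain_image:
  assumes "(f, g) \<in> (near_maps e S)\<^sup>*"
    and "\<And>f g. (f, g) \<in> near_maps e S \<Longrightarrow> (F f, F g) \<in> near_maps e' S'"
  shows "(F f, F g) \<in> (near_maps e' S')\<^sup>*"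
  using assms(1)
  by (induction rule: rtrancl_induct) (auto intro: assms(2) rtrancl_into_rtrancl)

text \<open>
  A window of length \<open>e / 2\<close> is moved to the left end of the set, one step at a time, and everything to
  the right of the window is already finite. If the set meets the interval of length \<open>e / 2\<close> just left of the
  boundary \<open>x\<close>, the window can be folded onto a point \<open>y\<close> there by \<open>s \<mapsto> min s y\<close>; otherwise
  the set has a gap to the left of \<open>x\<close>, so the part in the window is clopen and can be collapsed to
  one of its own points.
\<close>

lemma collapse_from_the_right:
  fixes S :: "real set"
  assumes "e > 0" "compact S" "S \<subseteq> {a..}" "finite (S \<inter> {a + real n * (e / 2) <..})"
  shows "\<exists>c. (id, c) \<in> (near_maps e S)\<^sup>* \<and> finite (c ` S)"
  using assms(2-)
proof (induction n arbitrary: S)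
  case 0
  have "S \<subseteq> insert a (S \<inter> {a<..})" using 0 by auto
  then have "finite S" using 0 by (metis finite.insertI finite_subset add_0_right mult_zero_left of_nat_0)
  then show ?case by (intro exI[of _ id]) auto
next
  case (Suc n)
  define x where "x = a + real n * (e / 2)"
  have fin: "finite (S \<inter> {x + e / 2 <..})"
    using Suc.prems(3) by (simp add: x_def algebra_simps add_divide_distrib)
  have clS: "closed S" using Suc.prems(1) compact_imp_closed by blast
  obtain d where d: "continuous_on S d" "d \<in> S \<rightarrow> S" "\<And>s. s \<in> S \<Longrightarrow> dist s (d s) < e"
    "d ` S \<inter> {x<..} \<subseteq> insert (d x) (d ` (S \<inter> {x + e / 2 <..}))"
  proof (cases "S \<inter> {x - e / 2 <.. x} = {}")
    case False
    then obtain y where y: "y \<in> S" "x - e / 2 < y" "y \<le> x" by auto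
    define d where "d s = (if s \<le> x + e / 2 then min s y else s)" for s
    have "continuous_on (S \<inter> {..x + e / 2}) d"
      by (rule continuous_on_eq[of _ "\<lambda>s. min s y"]) (auto simp: d_def intro!: continuous_intros)
    moreover have "continuous_on (S \<inter> {x + e / 2 <..}) d"
      using fin by (rule continuous_on_finite)
    moreover have "S = (S \<inter> {..x + e / 2}) \<union> (S \<inter> {x + e / 2 <..})" by auto
    ultimately have "continuous_on S d"
      using continuous_on_closed_Un[of "S \<inter> {..x + e / 2}" "S \<inter> {x + e / 2 <..}" d]
        clS fin by (auto simp: finite_imp_closed closed_Int)
    then show thesis
    proof (rule that)
      show "d \<in> S \<rightarrow> S" using y by (auto simp: d_def min_def)
      show "dist s (d s) < e" if "s \<in> S" for s
        using y assms(1) by (auto simp: d_def dist_real_def min_def)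
      show "d ` S \<inter> {x<..} \<subseteq> insert (d x) (d ` (S \<inter> {x + e / 2 <..}))"
        using y by (auto simp: d_def min_def split: if_splits)
    qed
  next
    case True
    \<comment> \<open>If the window misses \<open>S\<close>, then \<open>y\<close> is arbitrary: the constant branch of \<open>d\<close> is never reached on \<open>S\<close>.\<close>
    obtain y where y: "S \<inter> {x<..x + e / 2} \<noteq> {} \<Longrightarrow> y \<in> S \<inter> {x<..x + e / 2}"
      by blast
    define d where "d s = (if x \<le> s \<and> s \<le> x + e / 2 then y else s)" for s
    have "continuous_on (S \<inter> {..x - e / 2}) d"
      by (rule continuous_on_eq[of _ "\<lambda>s. s"]) (use assms(1) in \<open>auto simp: d_def intro!: continuous_intros\<close>)
    moreover have "continuous_on (S \<inter> {x..x + e / 2}) d"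
      by (rule continuous_on_eq[of _ "\<lambda>s. y"]) (auto simp: d_def intro!: continuous_intros)
    moreover have "continuous_on (S \<inter> {x + e / 2 <..}) d"
      using fin by (rule continuous_on_finite)
    moreover have "S = (S \<inter> {..x - e / 2}) \<union> (S \<inter> {x..x + e / 2}) \<union> (S \<inter> {x + e / 2 <..})"
      using True by force
    ultimately have "continuous_on S d"
      using continuous_on_closed_Un[of "S \<inter> {..x - e / 2}" "S \<inter> {x..x + e / 2}" d]
        continuous_on_closed_Un[of "(S \<inter> {..x - e / 2}) \<union> (S \<inter> {x..x + e / 2})" "S \<inter> {x + e / 2 <..}" d]
        clS fin by (auto simp: finite_imp_closed closed_Int closed_Un)
    then show thesis
    proof (rule that)
      have yS: "y \<in> S \<and> x < y \<and> y \<le> x + e / 2" if "s \<in> S" "x \<le> s" "s \<le> x + e / 2" for s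
      proof -
        have "s \<noteq> x" using True that assms(1) by auto
        then show ?thesis using y that by force
      qed
      then show "d \<in> S \<rightarrow> S" by (auto simp: d_def)
      show "dist s (d s) < e" if "s \<in> S" for s
        using yS[OF that] assms(1) by (auto simp: d_def dist_real_def)
      show "d ` S \<inter> {x<..} \<subseteq> insert (d x) (d ` (S \<inter> {x + e / 2 <..}))"
        using assms(1) by (auto simp: d_def split: if_splits)
    qed
  qed
  let ?S = "d ` S"
  have sub: "?S \<subseteq> S" using d(2) by auto
  have "finite (?S \<inter> {x<..})" using d(4) fin by (meson finite.insertI finite_imageI finite_subset)
  moreover have "compact ?S" using d(1) Suc.prems(1) by (rule compact_continuous_image)
  moreover have "?S \<subseteq> {a..}" using sub Suc.prems(2) by auto
  ultimately obtain c where c: "(id, c) \<in> (near_maps e ?S)\<^sup>*" "finite (c ` ?S)"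
    using Suc.IH[of ?S] unfolding x_def by blast
  have "(f \<circ> d, g \<circ> d) \<in> near_maps e S" if "(f, g) \<in> near_maps e ?S" for f g
    using that d(1) sub unfolding near_maps_def
    by (auto simp: Pi_iff image_subset_iff intro: continuous_on_compose2[OF _ d(1)])
  from near_maps_chain_image[where F = "\<lambda>f. f \<circ> d", OF c(1) this]
  have "(id \<circ> d, c \<circ> d) \<in> (near_maps e S)\<^sup>*" .
  moreover have "(id, id \<circ> d) \<in> near_maps e S"
    using d(1-3) by (auto simp: near_maps_def)
  ultimately have "(id, c \<circ> d) \<in> (near_maps e S)\<^sup>*" by (rule converse_rtrancl_into_rtrancl[rotated])
  moreover have "finite ((c \<circ> d) ` S)" using c(2) by (simp add: image_comp)
  ultimately show ?case by blast
qed

lemma collapsible_compact_real: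
  fixes S :: "real set"
  assumes "compact S"
  shows "collapsible S"
  unfolding collapsible_def
proof (intro allI impI)
  fix e :: real assume e: "e > 0"
  obtain b where b: "S \<subseteq> {-b..b}"
    using compact_imp_bounded[OF assms] unfolding bounded_iff by (force simp: abs_le_iff)
  obtain n :: nat where n: "2 * b / (e / 2) < real n" using reals_Archimedean2 by blast
  have "S \<inter> {- b + real n * (e / 2) <..} = {}"
    using b n e by (force simp: field_simps)
  then show "\<exists>c. (id, c) \<in> (near_maps e S)\<^sup>* \<and> finite (c ` S)"
    using collapse_from_the_right[OF e assms, of "-b" n] b by force
qed

lemma collapsible_Times:
  assumes "collapsible S" "collapsible T"
  shows "collapsible (S \<times> T)"
  unfolding collapsible_def
proof (intro allI impI)
  fix e :: real assume e: "e > 0"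
  obtain c where c: "(id, c) \<in> (near_maps e S)\<^sup>*" "finite (c ` S)"
    using assms(1) e unfolding collapsible_def by blast
  obtain d where d: "(id, d) \<in> (near_maps e T)\<^sup>*" "finite (d ` T)"
    using assms(2) e unfolding collapsible_def by blast
  have *: "continuous_on (S \<times> T) (map_prod f g)" if "continuous_on S f" "continuous_on T g" for f g
    unfolding map_prod_def case_prod_beta
    by (auto intro!: continuous_intros continuous_on_compose2[OF that(1)] continuous_on_compose2[OF that(2)])
  have "(map_prod f id, map_prod g id) \<in> near_maps e (S \<times> T)" if "(f, g) \<in> near_maps e S" for f g
    using that by (auto simp: near_maps_def Pi_iff dist_Pair_Pair intro!: *)
  from near_maps_chain_image[where F = "\<lambda>f. map_prod f id", OF c(1) this]
  have 1: "(map_prod id id, map_prod c id) \<in> (near_maps e (S \<times> T))\<^sup>*" .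
  have "(map_prod c f, map_prod c g) \<in> near_maps e (S \<times> T)" if "(f, g) \<in> near_maps e T" for f g
    using that near_maps_chain_end[OF c(1)]
    by (auto simp: near_maps_def Pi_iff dist_Pair_Pair intro!: *)
  from near_maps_chain_image[where F = "\<lambda>f. map_prod c f", OF d(1) this]
  have 2: "(map_prod c id, map_prod c d) \<in> (near_maps e (S \<times> T))\<^sup>*" .
  have "(id, map_prod c d) \<in> (near_maps e (S \<times> T))\<^sup>*"
    using rtrancl_trans[OF 1 2] by (simp add: prod.map_id0)
  moreover have "finite (map_prod c d ` (S \<times> T))"
    by (rule finite_subset[of _ "c ` S \<times> d ` T"]) (use c d in auto)
  ultimately show "\<exists>c. (id, c) \<in> (near_maps e (S \<times> T))\<^sup>* \<and> finite (c ` (S \<times> T))" by blast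
qed

text \<open>
  The metric on the power only sees finitely many coordinates up to \<open>e\<close>, so it is enough to collapse
  these coordinatewise and to freeze all the others. The explicit form of the last map is what shows
  that an integer-valued continuous function depends on finitely many coordinates.
\<close>

lemma collapse_power:
  fixes A :: "'a::metric_space set"
  assumes "collapsible A" "a \<in> A" "e > 0"
  obtains c and J :: "'i::countable set" where
    "finite J" "continuous_on A c" "c \<in> A \<rightarrow> A" "finite (c ` A)"
    "(id, \<lambda>\<omega> i. if i \<in> J then c (\<omega> i) else a) \<in> (near_maps e (UNIV \<rightarrow> A))\<^sup>*"
proof -
  obtain c where c: "(id, c) \<in> (near_maps (e / 4) A)\<^sup>*" "finite (c ` A)"
    using assms unfolding collapsible_def by (meson divide_pos_pos zero_less_numeral)
  obtain N where N: "(1 / 2) ^ N < e / 2"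
    using real_arch_pow_inv[of "e / 2" "1 / 2"] assms(3) by auto
  define J :: "'i set" where "J = from_nat ` {..N}"
  have near: "dist x y < e" if "\<And>i. i \<in> J \<Longrightarrow> dist (x i) (y i) < e / 4" for x y :: "'i \<Rightarrow> 'a"
  proof -
    have "Max {dist (x (from_nat n)) (y (from_nat n)) |n. n \<le> N} < e / 4"
      using that by (subst Max_less_iff) (auto simp: J_def)
    then show ?thesis
      using dist_fun_le_dist_first_terms[of x y N] N by linarith
  qed
  define F :: "('a \<Rightarrow> 'a) \<Rightarrow> ('i \<Rightarrow> 'a) \<Rightarrow> 'i \<Rightarrow> 'a"
    where "F f = (\<lambda>\<omega> i. if i \<in> J then f (\<omega> i) else a)" for f
  have contF: "continuous_on (UNIV \<rightarrow> A) (F f)" if "continuous_on A f" for f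
    unfolding F_def
  proof (rule continuous_on_coordinatewise_then_product)
    fix i :: 'i
    have "continuous_on (UNIV \<rightarrow> A) (\<lambda>\<omega> :: 'i \<Rightarrow> 'a. \<omega> i)"
      by (rule continuous_on_product_then_coordinatewise) (rule continuous_on_id)
    then show "continuous_on (UNIV \<rightarrow> A) (\<lambda>\<omega>. if i \<in> J then f (\<omega> i) else a)"
      using continuous_on_compose2[OF that, of "UNIV \<rightarrow> A" "\<lambda>\<omega>. \<omega> i"]
      by (cases "i \<in> J") (auto simp: continuous_on_const)
  qed
  have "(F f, F g) \<in> near_maps e (UNIV \<rightarrow> A)" if "(f, g) \<in> near_maps (e / 4) A" for f g
    using that assms(2) unfolding near_maps_def
    by (auto simp: F_def[symmetric] intro!: contF near) (auto simp: F_def)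
  from near_maps_chain_image[where F = F, OF c(1) this]
  have "(F id, F c) \<in> (near_maps e (UNIV \<rightarrow> A))\<^sup>*" .
  moreover have "(id, F id) \<in> near_maps e (UNIV \<rightarrow> A)"
    using assms unfolding near_maps_def
    by (auto intro!: contF near continuous_on_id) (auto simp: F_def)
  ultimately have "(id, F c) \<in> (near_maps e (UNIV \<rightarrow> A))\<^sup>*"
    by (rule converse_rtrancl_into_rtrancl[rotated])
  moreover have "finite J" by (simp add: J_def)
  ultimately show thesis
    using that[of J c] near_maps_chain_end[OF c(1)] c(2) unfolding F_def by auto
qed

lemma collapsible_power:
  fixes A :: "'a::metric_space set"
  assumes "collapsible A"
  shows "collapsible ((UNIV :: 'i::countable set) \<rightarrow> A)"
proof (cases "A = {}")
  case True
  then show ?thesis unfolding collapsible_def by (auto simp: Pi_def intro!: exI[of _ id])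
next
  case False
  then obtain a where a: "a \<in> A" by blast
  show ?thesis
    unfolding collapsible_def
  proof (intro allI impI)
    fix e :: real assume "e > 0"
    from assms a this obtain c and J :: "'i set" where J: "finite J" and c: "finite (c ` A)"
      "(id, \<lambda>\<omega> i. if i \<in> J then c (\<omega> i) else a) \<in> (near_maps e (UNIV \<rightarrow> A))\<^sup>*"
      by (rule collapse_power)
    have "(\<lambda>\<omega> i. if i \<in> J then c (\<omega> i) else a) ` (UNIV \<rightarrow> A) \<subseteq>
        (\<lambda>v i. if i \<in> J then v i else a) ` (J \<rightarrow>\<^sub>E c ` A)"
    proof (rule image_subsetI)
      fix \<omega> :: "'i \<Rightarrow> 'a" assume "\<omega> \<in> UNIV \<rightarrow> A"
      then show "(\<lambda>i. if i \<in> J then c (\<omega> i) else a) \<in> (\<lambda>v i. if i \<in> J then v i else a) ` (J \<rightarrow>\<^sub>E c ` A)"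
        by (intro image_eqI[of _ _ "\<lambda>i\<in>J. c (\<omega> i)"]) auto
    qed
    then have "finite ((\<lambda>\<omega> i. if i \<in> J then c (\<omega> i) else a) ` ((UNIV :: 'i set) \<rightarrow> A))"
      using finite_PiE[of J "\<lambda>_. c ` A"] J c(1) by (meson finite_imageI finite_subset)
    then show "\<exists>c. (id, c) \<in> (near_maps e ((UNIV :: 'i set) \<rightarrow> A))\<^sup>* \<and> finite (c ` (UNIV \<rightarrow> A))"
      using c(2) by blast
  qed
qed

lemma continuous_on_finite_factor:
  fixes c :: "'a::topological_space \<Rightarrow> 'b::t1_space"
  assumes "continuous_on S c" "finite (c ` S)"
  shows "continuous_on S (\<lambda>x. F (c x))"
  using continuous_on_compose2[OF continuous_on_finite[OF assms(2), of F] assms(1)] by simp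

text \<open>
  Consecutive maps of a fine chain change \<open>u\<close> by a quotient within distance \<open>1\<close> of \<open>1\<close>, whose
  principal logarithm is continuous; the last map has finite range, so there any choice of arguments
  is continuous.
\<close>

lemma circle_map_has_lift:
  fixes u :: "'a::metric_space \<Rightarrow> complex"
  assumes S: "compact S" "collapsible S"
    and u: "continuous_on S u" "\<And>x. x \<in> S \<Longrightarrow> norm (u x) = 1"
  obtains h where "continuous_on S h" "\<And>x. x \<in> S \<Longrightarrow> u x = cis (2 * pi * h x)"
proof -
  obtain e where e: "e > 0" "\<And>x y. x \<in> S \<Longrightarrow> y \<in> S \<Longrightarrow> dist x y < e \<Longrightarrow> dist (u x) (u y) < 1"
    using compact_uniformly_continuous[OF u(1) S(1)] unfolding uniformly_continuous_on_def
    by (metis zero_less_one)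
  obtain c where c: "(id, c) \<in> (near_maps e S)\<^sup>*" "finite (c ` S)"
    using S(2) e(1) unfolding collapsible_def by blast
  have "\<exists>h. continuous_on S h \<and> (\<forall>x\<in>S. u x = u (c x) * cis (2 * pi * h x))"
    using c(1)
  proof (induction rule: rtrancl_induct)
    case base
    show ?case by (intro exI[of _ "\<lambda>_. 0"]) auto
  next
    case (step f g)
    obtain h where h: "continuous_on S h" "\<And>x. x \<in> S \<Longrightarrow> u x = u (f x) * cis (2 * pi * h x)"
      using step.IH by blast
    have fg: "continuous_on S f" "continuous_on S g" "\<And>x. x \<in> S \<Longrightarrow> f x \<in> S" "\<And>x. x \<in> S \<Longrightarrow> g x \<in> S"
      "\<And>x. x \<in> S \<Longrightarrow> dist (f x) (g x) < e"
      using step.hyps(2) by (auto simp: near_maps_def)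
    define q where "q x = u (f x) / u (g x)" for x
    have nz: "u (g x) \<noteq> 0" if "x \<in> S" for x using u(2)[OF fg(4)[OF that]] by auto
    have q: "norm (q x) = 1" "q x \<notin> \<real>\<^sub>\<le>\<^sub>0" "q x \<noteq> 0" if "x \<in> S" for x
    proof -
      show 1: "norm (q x) = 1" by (simp add: q_def norm_divide u fg that)
      have "norm (u (f x) - u (g x)) < 1"
        using e(2)[OF fg(3,4,5)] that by (simp add: dist_norm)
      moreover have "norm (q x - 1) = norm (u (f x) - u (g x))"
        using u(2)[OF fg(4)[OF that]] nz[OF that]
        by (simp add: q_def field_simps norm_divide diff_divide_distrib[symmetric])
      ultimately have "norm (q x - 1) < 1" by simp
      then show "q x \<notin> \<real>\<^sub>\<le>\<^sub>0"
        using complex_Re_le_cmod[of "1 - q x"] by (auto simp: complex_nonpos_Reals_iff norm_minus_commute)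
      show "q x \<noteq> 0" using 1 by auto
    qed
    have contq: "continuous_on S q"
      unfolding q_def
      by (intro continuous_on_divide continuous_on_compose2[OF u(1)]) (use fg nz in auto)
    define h' where "h' x = h x + Im (Ln (q x)) / (2 * pi)" for x
    have "continuous_on S h'"
      unfolding h'_def by (intro continuous_intros h(1) contq) (use q in auto)
    moreover have "u x = u (g x) * cis (2 * pi * h' x)" if "x \<in> S" for x
    proof -
      have "cis (Im (Ln (q x))) = q x"
        using cis_Arg[OF q(3)[OF that]] Arg_eq_Im_Ln[OF q(3)[OF that]] q(1)[OF that]
        by (simp add: sgn_div_norm)
      moreover have "2 * pi * h' x = 2 * pi * h x + Im (Ln (q x))"
        by (simp add: h'_def field_simps)
      ultimately have "cis (2 * pi * h' x) = cis (2 * pi * h x) * q x"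
        by (simp add: cis_mult[symmetric])
      then show ?thesis using h(2)[OF that] nz[OF that] by (simp add: q_def)
    qed
    ultimately show ?case by blast
  qed
  then obtain h where h: "continuous_on S h" "\<And>x. x \<in> S \<Longrightarrow> u x = u (c x) * cis (2 * pi * h x)" by blast
  define h' where "h' x = h x + Arg (u (c x)) / (2 * pi)" for x
  have cS: "continuous_on S c" "c \<in> S \<rightarrow> S" using near_maps_chain_end[OF c(1)] by auto
  have "continuous_on S h'"
    unfolding h'_def by (intro continuous_intros h(1) continuous_on_finite_factor[OF cS(1) c(2)]) auto
  moreover have "u x = cis (2 * pi * h' x)" if "x \<in> S" for x
  proof -
    have 1: "norm (u (c x)) = 1" using u(2) cS that by auto
    then have "u (c x) \<noteq> 0" by auto
    then have "cis (Arg (u (c x))) = u (c x)"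
      using cis_Arg[of "u (c x)"] 1 by (simp add: sgn_div_norm)
    moreover have "2 * pi * h' x = 2 * pi * h x + Arg (u (c x))"
      by (simp add: h'_def field_simps)
    ultimately show ?thesis using h(2)[OF that] by (simp add: cis_mult[symmetric])
  qed
  ultimately show thesis using that by blast
qed

text \<open>
  An integer-valued function cannot change along a sufficiently fine chain.
\<close>

lemma integer_valued_factors:
  fixes k :: "'a::metric_space \<Rightarrow> real"
  assumes "compact S" "continuous_on S k" "k \<in> S \<rightarrow> \<int>"
  obtains e where "e > 0" "\<And>c x. (id, c) \<in> (near_maps e S)\<^sup>* \<Longrightarrow> x \<in> S \<Longrightarrow> k (c x) = k x"
proof -
  obtain e where e: "e > 0" "\<And>x y. x \<in> S \<Longrightarrow> y \<in> S \<Longrightarrow> dist x y < e \<Longrightarrow> dist (k x) (k y) < 1"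
    using compact_uniformly_continuous[OF assms(2,1)] unfolding uniformly_continuous_on_def
    by (metis zero_less_one)
  have "\<forall>x\<in>S. k (c x) = k x" if "(id, c) \<in> (near_maps e S)\<^sup>*" for c
    using that
  proof (induction rule: rtrancl_induct)
    case (step f g)
    have "k (f x) = k (g x)" if "x \<in> S" for x
    proof -
      have "f x \<in> S" "g x \<in> S" "dist (f x) (g x) < e"
        using step.hyps(2) that by (auto simp: near_maps_def)
      then have "\<bar>k (f x) - k (g x)\<bar> < 1" "k (f x) \<in> \<int>" "k (g x) \<in> \<int>"
        using e(2) assms(3) by (auto simp: dist_real_def)
      then show ?thesis using Ints_eq_abs_less1 by blast
    qed
    then show ?case using step.IH by auto
  qed auto
  then show thesis using that e(1) by blast
qed


section \<open>Lifting maps into the circle\<close>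

lemma quotient_map_quotient_topology:
  "quotient_map X (quotient_topology X R) (\<lambda>x. R `` {x})"
  unfolding quotient_map_def topspace_quotient_topology openin_quotient_topology
  by (auto simp: quotient_def)

lemma circle_class_eq: "circle_rel `` {s} = circle_rel `` {t} \<longleftrightarrow> s - t \<in> \<int>"
proof
  assume "circle_rel `` {s} = circle_rel `` {t}"
  then have "t \<in> circle_rel `` {s}" by (auto simp: circle_rel_def)
  then show "s - t \<in> \<int>" by (auto simp: circle_rel_def)
next
  assume *: "s - t \<in> \<int>"
  have "s - u \<in> \<int> \<longleftrightarrow> t - u \<in> \<int>" for u
    using Ints_diff[OF _ *, of "s - u"] Ints_add[OF *, of "t - u"] by (auto simp: algebra_simps)
  then show "circle_rel `` {s} = circle_rel `` {t}" by (auto simp: circle_rel_def)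
qed

lemma cis_eq_iff_diff_Ints: "cis (2 * pi * s) = cis (2 * pi * t) \<longleftrightarrow> s - t \<in> \<int>"
proof
  assume "cis (2 * pi * s) = cis (2 * pi * t)"
  then have "cis (2 * pi * (s - t)) = 1"
    by (simp add: right_diff_distrib flip: cis_divide)
  then have "cos (2 * pi * (s - t)) = 1" by (metis cis.sel(1) one_complex.sel(1))
  then obtain n :: int where "2 * pi * (s - t) = of_int n * 2 * pi" unfolding cos_one_2pi_int by blast
  then have "(2 * pi) * (s - t) = (2 * pi) * of_int n" by (simp only: mult_ac)
  then have "s - t = of_int n" by (simp only: mult_cancel_left) simp
  then show "s - t \<in> \<int>" by simp
next
  assume "s - t \<in> \<int>"
  then have "cis (2 * pi * (s - t)) = 1" by (rule cis_multiple_2pi)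
  then show "cis (2 * pi * s) = cis (2 * pi * t)"
    by (simp add: right_diff_distrib flip: cis_divide)
qed

text \<open>
  The homeomorphism of \<open>\<real> / \<int>\<close> with the complex unit circle, along which complex logarithms become
  available for maps into \<open>circle\<close>.
\<close>

definition circle_embed :: "real set \<Rightarrow> complex" where
  "circle_embed z = cis (2 * pi * (SOME t. t \<in> z))"

lemma circle_embed_class: "circle_embed (circle_rel `` {t}) = cis (2 * pi * t)"
proof -
  have "t \<in> circle_rel `` {t}" by (simp add: circle_rel_def)
  then have "(SOME s. s \<in> circle_rel `` {t}) \<in> circle_rel `` {t}" by (rule someI)
  then show ?thesis
    unfolding circle_embed_def cis_eq_iff_diff_Ints
    by (simp add: circle_rel_def) (metis Ints_minus minus_diff_eq)
qed

lemma circle_class_eqI: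
  assumes "z \<in> topspace circle" "circle_embed z = cis (2 * pi * t)"
  shows "circle_rel `` {t} = z"
proof -
  obtain s where z: "z = circle_rel `` {s}"
    using assms(1) by (auto simp: circle_def topspace_quotient_topology quotient_def)
  then show ?thesis
    using assms(2) unfolding circle_embed_class z cis_eq_iff_diff_Ints circle_class_eq
    by (metis Ints_minus minus_diff_eq)
qed

lemma continuous_map_circle_embed: "continuous_map circle euclidean circle_embed"
  unfolding circle_def
proof (rule continuous_compose_quotient_map[OF quotient_map_quotient_topology])
  show "continuous_map euclideanreal euclidean (circle_embed \<circ> (\<lambda>x. circle_rel `` {x}))"
    by (auto simp: o_def circle_embed_class cis_conv_exp intro!: continuous_intros)
qed

lemma norm_circle_embed: "norm (circle_embed z) = 1"
  by (simp add: circle_embed_def)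

lemma circle_lift_collapsible:
  fixes S :: "'a::metric_space set"
  assumes "compact S" "collapsible S" "continuous_map (top_of_set S) circle g"
  obtains h where "continuous_on S h" "\<And>x. x \<in> S \<Longrightarrow> circle_rel `` {h x} = g x"
proof -
  have "continuous_map (top_of_set S) euclidean (circle_embed \<circ> g)"
    using continuous_map_compose[OF assms(3) continuous_map_circle_embed] .
  then have "continuous_on S (\<lambda>x. circle_embed (g x))"
    by (simp add: o_def)
  from circle_map_has_lift[OF assms(1,2) this norm_circle_embed]
  obtain h where h: "continuous_on S h" "\<And>x. x \<in> S \<Longrightarrow> circle_embed (g x) = cis (2 * pi * h x)"
    by blast
  have "g x \<in> topspace circle" if "x \<in> S" for x
    using continuous_map_image_subset_topspace[OF assms(3)] that by (auto simp: image_subset_iff)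
  then show thesis using that[OF h(1)] h(2) circle_class_eqI by blast
qed

lemma circle_lift_real_line:
  assumes "continuous_map euclideanreal circle g"
  obtains f where "continuous_on UNIV f" "\<And>t. circle_rel `` {f t} = g t"
proof -
  have "continuous_map euclideanreal euclidean (circle_embed \<circ> g)"
    using continuous_map_compose[OF assms continuous_map_circle_embed] .
  then have cont: "continuous_on UNIV (\<lambda>x. circle_embed (g x))"
    by (simp add: o_def)
  have nz: "circle_embed (g x) \<noteq> 0" for x using norm_circle_embed[of "g x"] by auto
  obtain l where l: "continuous_on UNIV l" "\<And>x. circle_embed (g x) = exp (l x)"
    using continuous_logarithm_on_contractible[OF cont convex_imp_contractible nz] by auto
  have "Re (l x) = 0" for x
    using norm_circle_embed[of "g x"] by (simp add: l(2))
  then have "circle_embed (g x) = cis (2 * pi * (Im (l x) / (2 * pi)))" for x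
    by (simp add: l(2) exp_eq_polar)
  moreover have "g x \<in> topspace circle" for x
    using continuous_map_image_subset_topspace[OF assms] by (auto simp: image_subset_iff)
  ultimately have "circle_rel `` {Im (l x) / (2 * pi)} = g x" for x
    using circle_class_eqI by blast
  moreover have "continuous_on UNIV (\<lambda>x. Im (l x) / (2 * pi))"
    by (intro continuous_intros l) auto
  ultimately show thesis using that by blast
qed

lemma integer_valued_constant:
  fixes f :: "'a::topological_space \<Rightarrow> real"
  assumes "connected S" "continuous_on S f" "\<And>x. x \<in> S \<Longrightarrow> f x \<in> \<int>" "x \<in> S" "y \<in> S"
  shows "f x = f y"
proof -
  have "f constant_on S"
  proof (rule continuous_discrete_range_constant[OF assms(1,2)])
    fix x assume "x \<in> S"
    have "1 \<le> norm (f y - f x)" if "y \<in> S" "f y \<noteq> f x" for y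
      using Ints_eq_abs_less1[of "f y" "f x"] that assms(3) \<open>x \<in> S\<close> by force
    then show "\<exists>e>0. \<forall>y. y \<in> S \<and> f y \<noteq> f x \<longrightarrow> e \<le> norm (f y - f x)"
      by (intro exI[of _ 1]) auto
  qed
  then show ?thesis using assms(4,5) by (auto simp: constant_on_def)
qed

text \<open>
  Two lifts along the same orbit differ by a continuous integer-valued function, that is, by a
  constant.
\<close>

lemma lift_slope_unique:
  assumes "is_lift_along_orbit \<phi> x f" "((\<lambda>t. f t / t) \<longlongrightarrow> r) at_top"
    and "is_lift_along_orbit \<phi> x g" "((\<lambda>t. g t / t) \<longlongrightarrow> s) at_top"
  shows "r = s"
proof -
  have "continuous_on UNIV (\<lambda>t. f t - g t)"
    using assms(1,3) by (auto simp: is_lift_along_orbit_def intro!: continuous_intros)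
  moreover have "f t - g t \<in> \<int>" for t
    using assms(1,3) circle_class_eq[of "f t" "g t"] by (auto simp: is_lift_along_orbit_def)
  ultimately have const: "f t - g t = f 0 - g 0" for t
    using integer_valued_constant[of UNIV "\<lambda>t. f t - g t" t 0] by auto
  have "((\<lambda>t. f t / t - g t / t) \<longlongrightarrow> r - s) at_top"
    by (intro tendsto_intros assms)
  moreover have "(\<lambda>t. f t / t - g t / t) = (\<lambda>t. (f 0 - g 0) / t)"
    by (rule ext) (metis const diff_divide_distrib)
  moreover have "((\<lambda>t. (f 0 - g 0) / t) \<longlongrightarrow> 0) at_top"
    by (rule tendsto_divide_0[OF tendsto_const]) (simp add: filterlim_at_top_imp_at_infinity filterlim_ident)
  ultimately have "r - s = 0" using tendsto_unique[OF trivial_limit_at_top_linorder] by metis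
  then show ?thesis by simp
qed

section \<open>The suspension of the full shift\<close>

definition shift :: "int \<Rightarrow> (int \<Rightarrow> 'a) \<Rightarrow> int \<Rightarrow> 'a" where
  "shift n \<omega> = (\<lambda>i. \<omega> (i + n))"

definition sequences :: "real set \<Rightarrow> (int \<Rightarrow> real) set" where
  "sequences A = (UNIV \<rightarrow> A)"

lemma sequences_iff: "\<omega> \<in> sequences A \<longleftrightarrow> (\<forall>i. \<omega> i \<in> A)"
  by (auto simp: sequences_def)

lemma collapsible_sequences:
  assumes "compact A"
  shows "collapsible (sequences A)"
  unfolding sequences_def by (intro collapsible_power collapsible_compact_real assms)

lemma shift_0 [simp]: "shift 0 \<omega> = \<omega>" by (simp add: shift_def)

lemma shift_shift [simp]: "shift m (shift n \<omega>) = shift (m + n) \<omega>"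
  by (simp add: shift_def algebra_simps)

lemma shift_in_sequences [simp]: "shift n \<omega> \<in> sequences A \<longleftrightarrow> \<omega> \<in> sequences A"
  unfolding sequences_iff shift_def by (metis diff_add_cancel)

lemma full_shift_eq_shift: "full_shift = shift 1"
  by (simp add: full_shift_def shift_def fun_eq_iff)

lemma continuous_on_shift: "continuous_on S (shift n)"
  unfolding shift_def
  by (rule continuous_on_coordinatewise_then_product)
    (rule continuous_on_product_then_coordinatewise[OF continuous_on_id])

lemma full_shift_space_eq: "full_shift_space A = top_of_set (sequences A)"
  unfolding full_shift_space_def
  by (simp add: sequences_def euclidean_product_topology PiE_UNIV_domain flip: subtopology_product_topology)

lemma compact_sequences:
  assumes "compact A"
  shows "compact (sequences A)"
proof -
  have "compact_space (full_shift_space A)"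
    unfolding full_shift_space_def using assms by (simp add: compact_space_product_topology compact_space_subtopology)
  then show ?thesis
    unfolding full_shift_space_eq by (metis compactin_euclidean_iff compactin_subspace subset_UNIV topspace_euclidean)
qed

lemma int_iterate_full_shift:
  assumes "\<omega> \<in> sequences A"
  shows "int_iterate (full_shift_space A) full_shift n \<omega> = shift n \<omega>"
proof -
  have fwd: "(shift 1 ^^ m) \<omega> = shift (int m) \<omega>" for m
    by (induction m) (simp_all add: add.commute)
  have inj: "inj_on (shift 1) (sequences A)"
    by (rule inj_on_inverseI[of _ "shift (-1)"]) simp
  have "inv_into (sequences A) (shift 1) \<eta> = shift (-1) \<eta>" if "\<eta> \<in> sequences A" for \<eta> :: "int \<Rightarrow> real"
    by (rule inv_into_f_eq[OF inj]) (use that in auto)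
  then have bwd: "(inv_into (sequences A) (shift 1) ^^ m) \<omega> = shift (- int m) \<omega>" for m
    using assms by (induction m) (simp_all add: algebra_simps)
  show ?thesis
    unfolding int_iterate_def full_shift_space_eq full_shift_eq_shift by (simp add: fwd bwd)
qed

abbreviation shift_suspension :: "real set \<Rightarrow> ((int \<Rightarrow> real) \<times> real) set topology" where
  "shift_suspension A \<equiv> suspension (full_shift_space A) full_shift"

abbreviation shift_proj :: "real set \<Rightarrow> (int \<Rightarrow> real) \<times> real \<Rightarrow> ((int \<Rightarrow> real) \<times> real) set" where
  "shift_proj A \<equiv> suspension_proj (full_shift_space A) full_shift"

lemma shift_proj_class:
  "shift_proj A (\<eta>, t) = {(\<omega>, t + of_int n) | \<omega> n. \<omega> \<in> sequences A \<and> \<eta> = shift n \<omega>}"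
  unfolding suspension_proj_def suspension_rel_def
  by (auto simp: full_shift_space_eq int_iterate_full_shift[unfolded full_shift_space_eq])

lemma shift_proj_shift:
  assumes "\<omega> \<in> sequences A"
  shows "shift_proj A (shift n \<omega>, t) = shift_proj A (\<omega>, t + of_int n)"
proof -
  have *: "shift n \<omega> = shift m \<eta> \<longleftrightarrow> \<omega> = shift (m - n) \<eta>" for m and \<eta> :: "int \<Rightarrow> real"
  proof
    assume "shift n \<omega> = shift m \<eta>"
    then have "shift (- n) (shift n \<omega>) = shift (- n) (shift m \<eta>)" by simp
    then show "\<omega> = shift (m - n) \<eta>" by simp
  qed simp
  show ?thesis
    unfolding shift_proj_class *
  proof (intro set_eqI iffI; clarify)
    fix \<eta> :: "int \<Rightarrow> real" and m :: int assume "\<eta> \<in> sequences A"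
    then show "\<exists>\<omega>' n'. (\<eta>, t + of_int m) = (\<omega>', t + of_int n + of_int n') \<and>
        \<omega>' \<in> sequences A \<and> shift (m - n) \<eta> = shift n' \<omega>'"
      by (intro exI[of _ \<eta>] exI[of _ "m - n"]) simp
  next
    fix \<eta> :: "int \<Rightarrow> real" and m :: int assume "\<eta> \<in> sequences A"
    then show "\<exists>\<omega>' n'. (\<eta>, t + of_int n + of_int m) = (\<omega>', t + of_int n') \<and>
        \<omega>' \<in> sequences A \<and> shift m \<eta> = shift (n' - n) \<omega>'"
      by (intro exI[of _ \<eta>] exI[of _ "n + m"]) simp
  qed
qed

lemma shift_proj_eqD:
  assumes "\<omega> \<in> sequences A" "shift_proj A (\<omega>, s) = shift_proj A (\<eta>, t)"
  obtains n where "\<eta> = shift n \<omega>" "s = t + of_int n"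
proof -
  have "(\<omega>, s) \<in> shift_proj A (\<omega>, s)"
    unfolding shift_proj_class using assms(1) by (auto intro!: exI[of _ 0])
  then have "(\<omega>, s) \<in> shift_proj A (\<eta>, t)" by (simp only: assms(2))
  then show thesis unfolding shift_proj_class using that by auto
qed

lemma prod_full_shift_space: "prod_topology (full_shift_space A) euclideanreal = top_of_set (sequences A \<times> UNIV)"
  unfolding full_shift_space_eq using prod_topology_subtopology_eu[of "sequences A" "UNIV :: real set"] by simp

lemma quotient_map_shift_proj:
  "quotient_map (top_of_set (sequences A \<times> UNIV)) (shift_suspension A) (shift_proj A)"
  unfolding suspension_def suspension_proj_def prod_full_shift_space
  by (rule quotient_map_quotient_topology)

lemmas continuous_map_shift_proj = quotient_imp_continuous_map[OF quotient_map_shift_proj]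

lemma topspace_shift_suspension: "topspace (shift_suspension A) = shift_proj A ` (sequences A \<times> UNIV)"
  using quotient_imp_surjective_map[OF quotient_map_shift_proj, of A] by simp

text \<open>
  The closed box \<open>A\<^sup>\<int> \<times> [0, 1]\<close> is a compact fundamental domain: the suspension arises from it by
  gluing \<open>(\<omega>, 1)\<close> to \<open>(T \<omega>, 0)\<close>. The failure of a lift to respect the gluing is recorded by
  \<open>winding\<close>.
\<close>

definition box_lift ::
    "real set \<Rightarrow> (((int \<Rightarrow> real) \<times> real) set \<Rightarrow> real set) \<Rightarrow> ((int \<Rightarrow> real) \<times> real \<Rightarrow> real) \<Rightarrow> bool" where
  "box_lift A \<phi> H \<longleftrightarrow> continuous_on (sequences A \<times> {0..1}) H \<and>
     (\<forall>p \<in> sequences A \<times> {0..1}. circle_rel `` {H p} = \<phi> (shift_proj A p))"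

definition winding :: "((int \<Rightarrow> real) \<times> real \<Rightarrow> real) \<Rightarrow> (int \<Rightarrow> real) \<Rightarrow> real" where
  "winding H \<omega> = H (\<omega>, 1) - H (shift 1 \<omega>, 0)"

lemma box_lift_exists:
  assumes "compact A" "continuous_map (shift_suspension A) circle \<phi>"
  obtains H where "box_lift A \<phi> H"
proof -
  have "continuous_map (top_of_set (sequences A \<times> {0..1})) circle (\<phi> \<circ> shift_proj A)"
    by (rule continuous_map_from_subtopology_mono[OF continuous_map_compose[OF continuous_map_shift_proj assms(2)]]) auto
  moreover have "collapsible (sequences A \<times> {0..1::real})"
    by (intro collapsible_Times collapsible_sequences collapsible_compact_real assms compact_Icc)
  moreover have "compact (sequences A \<times> {0..1::real})"
    by (intro compact_Times compact_sequences assms compact_Icc)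
  ultimately obtain H where "continuous_on (sequences A \<times> {0..1}) H"
      "\<And>p. p \<in> sequences A \<times> {0..1} \<Longrightarrow> circle_rel `` {H p} = (\<phi> \<circ> shift_proj A) p"
    using circle_lift_collapsible by blast
  then show thesis using that unfolding box_lift_def o_def by blast
qed

lemma continuous_on_winding:
  assumes "continuous_on (sequences A \<times> {0..1}) H"
  shows "continuous_on (sequences A) (winding H)"
  unfolding winding_def
proof (intro continuous_on_diff)
  show "continuous_on (sequences A) (\<lambda>\<omega>. H (\<omega>, 1))"
    by (rule continuous_on_compose2[OF assms, of _ "\<lambda>\<omega>. (\<omega>, 1)"]) (auto intro!: continuous_intros)
  show "continuous_on (sequences A) (\<lambda>\<omega>. H (shift 1 \<omega>, 0))"
    by (rule continuous_on_compose2[OF assms, of _ "\<lambda>\<omega>. (shift 1 \<omega>, 0)"])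
      (auto intro!: continuous_intros continuous_on_shift)
qed

lemma winding_Ints:
  assumes "box_lift A \<phi> H" "\<omega> \<in> sequences A"
  shows "winding H \<omega> \<in> \<int>"
proof -
  have "circle_rel `` {H (\<omega>, 1)} = circle_rel `` {H (shift 1 \<omega>, 0)}"
    using assms shift_proj_shift[OF assms(2), of 1 0] by (simp add: box_lift_def)
  then show ?thesis by (simp add: winding_def circle_class_eq)
qed

text \<open>
  The homotopy is itself lifted, over \<open>[0, 1] \<times> A\<^sup>\<int> \<times> [0, 1]\<close>. The winding of the lift at time \<open>s\<close>
  is an integer depending continuously on \<open>s\<close>.
\<close>

lemma homotopic_box_lifts:
  assumes "compact A" "homotopic_with (\<lambda>_. True) (shift_suspension A) circle \<phi> \<psi>"
  obtains H K where "box_lift A \<phi> H" "box_lift A \<psi> K"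
    "\<And>\<omega>. \<omega> \<in> sequences A \<Longrightarrow> winding H \<omega> = winding K \<omega>"
proof -
  obtain h where h: "continuous_map (prod_topology (top_of_set {0..1::real}) (shift_suspension A)) circle h"
    "\<And>x. h (0, x) = \<phi> x" "\<And>x. h (1, x) = \<psi> x"
    using assms(2) unfolding homotopic_with_def by blast
  let ?B = "sequences A \<times> {0..1::real}"
  have "continuous_map (top_of_set ?B) (shift_suspension A) (shift_proj A)"
    by (rule continuous_map_from_subtopology_mono[OF continuous_map_shift_proj]) auto
  then have "continuous_map (prod_topology (top_of_set {0..1}) (top_of_set ?B))
      (prod_topology (top_of_set {0..1::real}) (shift_suspension A)) (\<lambda>(s, p). (s, shift_proj A p))"
    unfolding continuous_map_prod_top by (simp add: continuous_map_id[unfolded id_def])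
  from continuous_map_compose[OF this h(1)]
  have "continuous_map (top_of_set ({0..1} \<times> ?B)) circle (h \<circ> (\<lambda>(s, p). (s, shift_proj A p)))"
    by simp
  moreover have "collapsible ({0..1::real} \<times> ?B)"
    by (intro collapsible_Times collapsible_sequences collapsible_compact_real assms compact_Icc)
  moreover have "compact ({0..1::real} \<times> ?B)"
    by (intro compact_Times compact_sequences assms compact_Icc)
  ultimately obtain G where G: "continuous_on ({0..1} \<times> ?B) G"
      "\<And>q. q \<in> {0..1} \<times> ?B \<Longrightarrow> circle_rel `` {G q} = (h \<circ> (\<lambda>(s, p). (s, shift_proj A p))) q"
    using circle_lift_collapsible by blast
  define H where "H s = (\<lambda>p. G (s, p))" for s
  have contH: "continuous_on ?B (H s)" if "s \<in> {0..1}" for s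
    unfolding H_def by (rule continuous_on_compose2[OF G(1)]) (use that in \<open>auto intro!: continuous_intros\<close>)
  have "box_lift A (\<lambda>x. h (s, x)) (H s)" if "s \<in> {0..1}" for s
    using contH[OF that] G(2) that unfolding box_lift_def H_def by auto
  note lifts = this
  have "winding (H 0) \<omega> = winding (H 1) \<omega>" if \<omega>: "\<omega> \<in> sequences A" for \<omega>
  proof (rule integer_valued_constant[of "{0..1::real}" "\<lambda>s. winding (H s) \<omega>"])
    show "continuous_on {0..1} (\<lambda>s. winding (H s) \<omega>)"
      unfolding winding_def H_def
    proof (intro continuous_on_diff)
      show "continuous_on {0..1} (\<lambda>s. G (s, \<omega>, 1))"
        by (rule continuous_on_compose2[OF G(1), of _ "\<lambda>s. (s, \<omega>, 1)"])
          (use \<omega> in \<open>auto intro!: continuous_intros\<close>)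
      show "continuous_on {0..1} (\<lambda>s. G (s, shift 1 \<omega>, 0))"
        by (rule continuous_on_compose2[OF G(1), of _ "\<lambda>s. (s, shift 1 \<omega>, 0)"])
          (use \<omega> in \<open>auto intro!: continuous_intros\<close>)
    qed
    show "winding (H s) \<omega> \<in> \<int>" if "s \<in> {0..1}" for s
      using winding_Ints[OF lifts[OF that] \<omega>] .
  qed auto
  moreover have "box_lift A \<phi> (H 0)" "box_lift A \<psi> (H 1)"
    using lifts[of 0] lifts[of 1] by (auto simp: h)
  ultimately show thesis using that by blast
qed

text \<open>
  On each unit interval the lift \<open>F\<close> differs from \<open>H\<close>, evaluated over the shifted sequence, by an
  integer constant, and this constant grows by one value of the winding at each integer time.
\<close>

lemma lift_along_orbit_eq:
  assumes H: "box_lift A \<phi> H" and \<omega>: "\<omega> \<in> sequences A"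
    and F: "continuous_on UNIV F" "\<And>t. circle_rel `` {F t} = \<phi> (shift_proj A (\<omega>, t))"
    and "t \<in> {0..1}"
  shows "F (real n + t) = F 0 - H (\<omega>, 0) + H (shift (int n) \<omega>, t) + (\<Sum>j<n. winding H (shift (int j) \<omega>))"
  using assms(5)
proof (induction n arbitrary: t)
  have const: "F (real n + t) - H (shift (int n) \<omega>, t) = F (real n) - H (shift (int n) \<omega>, 0)"
    if t: "t \<in> {0..1}" for n t
  proof -
    have "F (real n + t) - H (shift (int n) \<omega>, t) = F (real n + 0) - H (shift (int n) \<omega>, 0)"
    proof (rule integer_valued_constant[of "{0..1::real}" "\<lambda>t. F (real n + t) - H (shift (int n) \<omega>, t)"])
      have "continuous_on {0..1} (\<lambda>t. F (real n + t))"
        by (rule continuous_on_compose2[OF F(1)]) (auto intro!: continuous_intros)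
      moreover have "continuous_on {0..1} (\<lambda>t. H (shift (int n) \<omega>, t))"
        using H unfolding box_lift_def
        by (auto intro!: continuous_on_compose2[of "sequences A \<times> {0..1}" H] continuous_intros \<omega>)
      ultimately show "continuous_on {0..1} (\<lambda>t. F (real n + t) - H (shift (int n) \<omega>, t))"
        by (intro continuous_on_diff)
      fix t :: real assume "t \<in> {0..1}"
      then have "circle_rel `` {H (shift (int n) \<omega>, t)} = \<phi> (shift_proj A (\<omega>, real n + t))"
        using H \<omega> shift_proj_shift[OF \<omega>, of "int n" t] unfolding box_lift_def by (simp add: add.commute)
      then show "F (real n + t) - H (shift (int n) \<omega>, t) \<in> \<int>"
        by (metis F(2) circle_class_eq)
    qed (use t in auto)
    then show ?thesis by simp
  qed
  {
    case 0
    then show ?case using const[of t 0] by simp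
  next
    case (Suc n)
    have "F (real (Suc n)) = F (real n + 1)" by (simp add: add.commute)
    also have "\<dots> = F 0 - H (\<omega>, 0) + H (shift (int n) \<omega>, 1) + (\<Sum>j<n. winding H (shift (int j) \<omega>))"
      by (rule Suc.IH) simp
    finally show ?case using const[of t "Suc n"] Suc.prems by (simp add: winding_def add.commute)
  }
qed

text \<open>
  This turns convergence of discrete averages into convergence in continuous time.
\<close>

lemma slope_of_floor_sums:
  fixes F :: "real \<Rightarrow> real" and S :: "nat \<Rightarrow> real"
  assumes "(\<lambda>n. S n / real n) \<longlonglongrightarrow> r"
    and "\<And>t. t \<ge> 0 \<Longrightarrow> \<bar>F t - S (nat \<lfloor>t\<rfloor>)\<bar> \<le> C"
  shows "((\<lambda>t. F t / t) \<longlongrightarrow> r) at_top"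
proof -
  have nat_floor: "filterlim (\<lambda>t::real. nat \<lfloor>t\<rfloor>) sequentially at_top"
    using filterlim_compose[OF filterlim_nat_sequentially filterlim_floor_sequentially] by simp
  have "((\<lambda>t::real. S (nat \<lfloor>t\<rfloor>) / real (nat \<lfloor>t\<rfloor>)) \<longlongrightarrow> r) at_top"
    using filterlim_compose[OF assms(1) nat_floor] .
  moreover have "((\<lambda>t::real. real_of_int \<lfloor>t\<rfloor> / t) \<longlongrightarrow> 1) at_top" by real_asymp
  ultimately have "((\<lambda>t::real. S (nat \<lfloor>t\<rfloor>) / real (nat \<lfloor>t\<rfloor>) * (real_of_int \<lfloor>t\<rfloor> / t)) \<longlongrightarrow> r * 1) at_top"
    by (rule tendsto_mult)
  moreover have "((\<lambda>t. (F t - S (nat \<lfloor>t\<rfloor>)) / t) \<longlongrightarrow> 0) at_top"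
  proof (rule Lim_null_comparison)
    show "\<forall>\<^sub>F t in at_top. norm ((F t - S (nat \<lfloor>t\<rfloor>)) / t) \<le> C / t"
      using eventually_gt_at_top[of 0]
      by eventually_elim (use assms(2) in \<open>auto simp: divide_simps\<close>)
    show "((\<lambda>t. C / t) \<longlongrightarrow> 0) at_top" by real_asymp
  qed
  ultimately have "((\<lambda>t::real. S (nat \<lfloor>t\<rfloor>) / real (nat \<lfloor>t\<rfloor>) * (real_of_int \<lfloor>t\<rfloor> / t)
      + (F t - S (nat \<lfloor>t\<rfloor>)) / t) \<longlongrightarrow> r * 1 + 0) at_top"
    by (rule tendsto_add)
  then show ?thesis
    unfolding mult_1_right add_0_right
  proof (rule Lim_transform_eventually)
    show "\<forall>\<^sub>F t in at_top. S (nat \<lfloor>t\<rfloor>) / real (nat \<lfloor>t\<rfloor>) * (real_of_int \<lfloor>t\<rfloor> / t)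
      + (F t - S (nat \<lfloor>t\<rfloor>)) / t = F t / t"
      using eventually_ge_at_top[of 1]
    proof eventually_elim
      case (elim t)
      then have "\<lfloor>t\<rfloor> \<ge> 1" by linarith
      then have pos: "real (nat \<lfloor>t\<rfloor>) > 0" and eq: "real_of_int \<lfloor>t\<rfloor> = real (nat \<lfloor>t\<rfloor>)"
        by linarith+
      show ?case unfolding eq using elim less_imp_neq[OF pos] by (simp add: add_divide_distrib[symmetric] del: of_nat_nat)
    qed
  qed
qed

lemma lift_slope_eq_mean_winding:
  assumes "compact A" "continuous_map (shift_suspension A) circle \<phi>" "box_lift A \<phi> H"
    and \<omega>: "\<omega> \<in> sequences A"
    and lim: "(\<lambda>n. (\<Sum>j<n. winding H (shift (int j) \<omega>)) / real n) \<longlonglongrightarrow> r"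
  shows "\<exists>f. is_lift_along_orbit \<phi> (shift_proj A (\<omega>, s)) f \<and> ((\<lambda>t. f t / t) \<longlongrightarrow> r) at_top"
proof -
  have "continuous_map euclideanreal (top_of_set (sequences A \<times> UNIV)) (\<lambda>t. (\<omega>, t))"
    using \<omega> by (auto intro!: continuous_intros simp: continuous_map_in_subtopology)
  from continuous_map_compose[OF this continuous_map_compose[OF continuous_map_shift_proj assms(2)]]
  have "continuous_map euclideanreal circle (\<lambda>t. \<phi> (shift_proj A (\<omega>, t)))" by (simp add: o_def)
  from circle_lift_real_line[OF this]
  obtain F where F: "continuous_on UNIV F" "\<And>t. circle_rel `` {F t} = \<phi> (shift_proj A (\<omega>, t))"
    by blast
  define f where "f t = F (s + t)" for t
  have "is_lift_along_orbit \<phi> (shift_proj A (\<omega>, s)) f"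
    unfolding is_lift_along_orbit_def f_def suspension_flow_proj
    by (auto simp: F(2) add.commute intro!: continuous_on_compose2[OF F(1)] continuous_intros)
  moreover have "((\<lambda>t. f t / t) \<longlongrightarrow> r) at_top"
  proof -
    have "compact (H ` (sequences A \<times> {0..1}))"
      using assms(1,3) unfolding box_lift_def
      by (intro compact_continuous_image compact_Times compact_sequences) auto
    then have "bounded (H ` (sequences A \<times> {0..1}))" by (rule compact_imp_bounded)
    then obtain B where "\<forall>x \<in> H ` (sequences A \<times> {0..1}). norm x \<le> B" unfolding bounded_iff by blast
    then have B: "\<bar>H p\<bar> \<le> B" if "p \<in> sequences A \<times> {0..1}" for p using that by auto
    have "((\<lambda>t. F t / t) \<longlongrightarrow> r) at_top"
    proof (rule slope_of_floor_sums[OF lim])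
      fix t :: real assume t: "t \<ge> 0"
      define n where "n = nat \<lfloor>t\<rfloor>"
      have fr: "t - real n \<in> {0..1}" using t unfolding n_def by (simp) linarith
      from lift_along_orbit_eq[OF assms(3) \<omega> F fr, of n]
      have "F t - (\<Sum>j<n. winding H (shift (int j) \<omega>)) = F 0 - H (\<omega>, 0) + H (shift (int n) \<omega>, t - real n)"
        by simp
      moreover have "\<bar>H (shift (int n) \<omega>, t - real n)\<bar> \<le> B"
        using fr \<omega> by (intro B) auto
      ultimately show "\<bar>F t - (\<Sum>j<nat \<lfloor>t\<rfloor>. winding H (shift (int j) \<omega>))\<bar> \<le> \<bar>F 0 - H (\<omega>, 0)\<bar> + B"
        unfolding n_def by linarith
    qed
    then have "((\<lambda>t. F (s + t) / (s + t)) \<longlongrightarrow> r) at_top"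
      by (rule filterlim_compose) (rule filterlim_tendsto_add_at_top[OF tendsto_const filterlim_ident])
    moreover have "((\<lambda>t. (s + t) / t) \<longlongrightarrow> 1) at_top" by real_asymp
    ultimately have "((\<lambda>t. F (s + t) / (s + t) * ((s + t) / t)) \<longlongrightarrow> r * 1) at_top"
      by (rule tendsto_mult)
    then show ?thesis
      unfolding mult_1_right add_0_right
  proof (rule Lim_transform_eventually)
      show "\<forall>\<^sub>F t in at_top. F (s + t) / (s + t) * ((s + t) / t) = f t / t"
        using eventually_gt_at_top[of "-s"] unfolding f_def
        by eventually_elim auto
    qed
  qed
  ultimately show ?thesis by blast
qed


section \<open>A strong law for sequences with finite-range dependence\<close>

text \<open>
  Between consecutive squares the partial sums of a bounded sequence move by at most \<open>2 m B\<close>, which is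
  negligible compared with \<open>m\<^sup>2\<close>.
\<close>

lemma cesaro_null_from_squares:
  fixes x :: "nat \<Rightarrow> real"
  assumes bound: "\<And>i. \<bar>x i\<bar> \<le> B"
    and sq: "(\<lambda>m. (\<Sum>i<m\<^sup>2. x i) / real (m\<^sup>2)) \<longlonglongrightarrow> 0"
  shows "(\<lambda>n. (\<Sum>i<n. x i) / real n) \<longlonglongrightarrow> 0"
proof -
  have B: "B \<ge> 0" using bound[of 0] by linarith
  have sqrt_lim: "filterlim floor_sqrt sequentially sequentially"
    unfolding filterlim_at_top by (auto simp: eventually_sequentially le_floor_sqrt_iff)
  \<comment> \<open>An upper bound for the average up to \<open>n\<close>, where \<open>m\<^sup>2\<close> is the last square before \<open>n\<close>.\<close>
  define R where "R m = \<bar>(\<Sum>i<m\<^sup>2. x i) / real (m\<^sup>2)\<bar> + 2 * B / real m" for m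
  have "R \<longlonglongrightarrow> \<bar>0\<bar> + 0"
    unfolding R_def by (intro tendsto_intros sq lim_const_over_n)
  from filterlim_compose[OF this sqrt_lim]
  have R: "(\<lambda>n. R (floor_sqrt n)) \<longlonglongrightarrow> 0" by simp
  show ?thesis
  proof (rule Lim_null_comparison[OF _ R])
    show "\<forall>\<^sub>F n in sequentially. norm ((\<Sum>i<n. x i) / real n) \<le> R (floor_sqrt n)"
      using eventually_ge_at_top[of 1]
    proof eventually_elim
      case (elim n)
      define m where "m = floor_sqrt n"
      have m: "m\<^sup>2 \<le> n" "n - m\<^sup>2 \<le> 2 * m" "m > 0"
        using Suc_floor_sqrt_power2_gt[of n] floor_sqrt_power2_le[of n] elim by (auto simp: m_def power2_eq_square)
      have "{..<n} = {..<m\<^sup>2} \<union> {m\<^sup>2..<n}" using m(1) by auto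
      then have "(\<Sum>i<n. x i) = (\<Sum>i<m\<^sup>2. x i) + (\<Sum>i=m\<^sup>2..<n. x i)"
        by (simp add: sum.union_disjoint ivl_disj_int)
      moreover have "\<bar>\<Sum>i=m\<^sup>2..<n. x i\<bar> \<le> 2 * real m * B"
      proof -
        have "\<bar>\<Sum>i=m\<^sup>2..<n. x i\<bar> \<le> real (card {m\<^sup>2..<n}) * B"
          using sum_norm_bound[of "{m\<^sup>2..<n}" x B] bound by auto
        also have "\<dots> \<le> real (2 * m) * B"
          using m(2) B by (intro mult_right_mono) (simp_all only: card_atLeastLessThan of_nat_le_iff)
        finally show ?thesis by simp
      qed
      ultimately have "\<bar>\<Sum>i<n. x i\<bar> \<le> \<bar>\<Sum>i<m\<^sup>2. x i\<bar> + 2 * real m * B" by linarith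
      then have "\<bar>\<Sum>i<n. x i\<bar> / real n \<le> (\<bar>\<Sum>i<m\<^sup>2. x i\<bar> + 2 * real m * B) / real (m\<^sup>2)"
        using m B by (intro frac_le) (auto intro!: add_nonneg_nonneg simp del: of_nat_power)
      also have "\<dots> = R m" using m(3) by (simp add: R_def field_simps power2_eq_square)
      finally show ?case by (simp add: m_def)
    qed
  qed
qed

text \<open>
  Only the pairs with \<open>\<bar>i - j\<bar> < L\<close> contribute to the second moment of the \<open>n\<close>-th partial sum, which
  is therefore \<open>O(n)\<close>. Along the squares the second moments of the averages are summable, so the
  averages converge to zero almost surely; boundedness fills in the other indices.
\<close>

lemma (in prob_space) strong_law_finite_range:
  fixes X :: "nat \<Rightarrow> 'a \<Rightarrow> real"
  assumes [measurable]: "\<And>i. X i \<in> borel_measurable M"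
    and bound: "\<And>i x. x \<in> space M \<Longrightarrow> \<bar>X i x\<bar> \<le> B"
    and orth: "\<And>i j. i + L \<le> j \<Longrightarrow> expectation (\<lambda>x. X i x * X j x) = 0"
  shows "AE x in M. (\<lambda>n. (\<Sum>i<n. X i x) / real n) \<longlonglongrightarrow> 0"
proof -
  obtain x where "x \<in> space M" using not_empty by blast
  then have B: "B \<ge> 0" using bound[of x 0] by linarith
  have prod_bound: "\<bar>X i x * X j x\<bar> \<le> B\<^sup>2" if "x \<in> space M" for i j x
    using bound[OF that, of i] bound[OF that, of j] B
    by (auto simp: abs_mult power2_eq_square intro: mult_mono)
  have int: "integrable M (\<lambda>x. X i x * X j x)" for i j
    by (rule integrable_const_bound[of _ "B\<^sup>2"]) (auto intro!: AE_I2 prod_bound)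
  have cov: "expectation (\<lambda>x. X i x * X j x) \<le> B\<^sup>2" for i j
  proof -
    have "expectation (\<lambda>x. X i x * X j x) \<le> expectation (\<lambda>x. B\<^sup>2)"
      using prod_bound by (intro integral_mono int) (auto simp: abs_le_iff)
    then show ?thesis by (simp add: prob_space)
  qed
  define C where "C = 2 * real L * B\<^sup>2"
  have second_moment: "expectation (\<lambda>x. (\<Sum>i<n. X i x)\<^sup>2) \<le> real n * C" for n
  proof -
    have "expectation (\<lambda>x. (\<Sum>i<n. X i x)\<^sup>2) = expectation (\<lambda>x. \<Sum>i<n. \<Sum>j<n. X i x * X j x)"
      by (simp add: power2_eq_square sum_product)
    also have "\<dots> = (\<Sum>i<n. \<Sum>j<n. expectation (\<lambda>x. X i x * X j x))"
      by (simp add: int)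
    also have "\<dots> \<le> (\<Sum>i<n. C)"
    proof (rule sum_mono)
      fix i
      have "(\<Sum>j<n. expectation (\<lambda>x. X i x * X j x)) \<le> (\<Sum>j<n. if j \<in> {i - L..<i + L} then B\<^sup>2 else 0)"
      proof (rule sum_mono)
        fix j
        have "expectation (\<lambda>x. X i x * X j x) = 0" if "j \<notin> {i - L..<i + L}"
        proof (cases "i + L \<le> j")
          case False
          then have "j + L \<le> i" using that by auto
          from orth[OF this] show ?thesis by (simp add: mult.commute)
        qed (rule orth)
        then show "expectation (\<lambda>x. X i x * X j x) \<le> (if j \<in> {i - L..<i + L} then B\<^sup>2 else 0)"
          using cov[of i j] by auto
      qed
      also have "\<dots> = (\<Sum>j \<in> {..<n} \<inter> {i - L..<i + L}. B\<^sup>2)"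
        by (rule sum.inter_restrict[symmetric]) simp
      also have "\<dots> = real (card ({..<n} \<inter> {i - L..<i + L})) * B\<^sup>2" by simp
      also have "\<dots> \<le> real (2 * L) * B\<^sup>2"
      proof (intro mult_right_mono)
        have "card ({..<n} \<inter> {i - L..<i + L}) \<le> card {i - L..<i + L}" by (intro card_mono) auto
        then show "real (card ({..<n} \<inter> {i - L..<i + L})) \<le> real (2 * L)" by simp
      qed simp
      finally show "(\<Sum>j<n. expectation (\<lambda>x. X i x * X j x)) \<le> C" by (simp add: C_def)
    qed
    finally show ?thesis by simp
  qed
  \<comment> \<open>The index is shifted by one to keep the square in the denominator nonzero.\<close>
  define Y where "Y m x = ((\<Sum>i<(Suc m)\<^sup>2. X i x) / real ((Suc m)\<^sup>2))\<^sup>2" for m x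
  have [measurable]: "Y m \<in> borel_measurable M" for m unfolding Y_def by measurable
  have Yint: "(\<integral>\<^sup>+x. ennreal (Y m x) \<partial>M) \<le> ennreal (C / (real (Suc m))\<^sup>2)" for m
  proof -
    let ?N = "(Suc m)\<^sup>2"
    have "(\<integral>\<^sup>+x. ennreal (Y m x) \<partial>M) = ennreal (expectation (Y m))"
    proof (rule nn_integral_eq_integral)
      have "integrable M (\<lambda>x. \<Sum>i<n. \<Sum>j<n. X i x * X j x)" for n by (simp add: int)
      then have "integrable M (\<lambda>x. (\<Sum>i<n. X i x)\<^sup>2)" for n
        by (simp add: power2_eq_square sum_product)
      then show "integrable M (Y m)" unfolding Y_def[abs_def] power_divide
        by (rule integrable_divide)
    qed (simp add: Y_def)
    also have "expectation (Y m) = expectation (\<lambda>x. (\<Sum>i<?N. X i x)\<^sup>2) / (real ?N)\<^sup>2"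
      unfolding Y_def[abs_def] power_divide by (rule integral_divide_zero)
    also have "\<dots> \<le> real ?N * C / (real ?N)\<^sup>2"
      by (intro divide_right_mono second_moment) simp
    also have "\<dots> = C / (real (Suc m))\<^sup>2"
      unfolding of_nat_power by (simp add: power2_eq_square del: of_nat_Suc)
    finally show ?thesis by (simp add: ennreal_leI)
  qed
  have "summable (\<lambda>m. C / (real (Suc m))\<^sup>2)"
    using summable_mult[OF inverse_power_summable[of 2], of C, THEN summable_ignore_initial_segment, of 1]
    by (simp add: field_simps)
  then have "(\<Sum>m. ennreal (C / (real (Suc m))\<^sup>2)) \<noteq> \<infinity>"
    by (subst suminf_ennreal2) (auto simp: C_def)
  moreover have "(\<integral>\<^sup>+x. (\<Sum>m. ennreal (Y m x)) \<partial>M) \<le> (\<Sum>m. ennreal (C / (real (Suc m))\<^sup>2))"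
    by (subst nn_integral_suminf) (auto intro!: suminf_le Yint simp del: of_nat_Suc)
  ultimately have "(\<integral>\<^sup>+x. (\<Sum>m. ennreal (Y m x)) \<partial>M) \<noteq> \<infinity>"
    by (auto simp: top_unique)
  then have "AE x in M. (\<Sum>m. ennreal (Y m x)) \<noteq> \<infinity>"
    by (intro nn_integral_noteq_infinite) auto
  then show ?thesis
    using AE_space
  proof eventually_elim
    case (elim x)
    have "summable (\<lambda>m. Y m x)"
      by (rule summable_suminf_not_top) (use elim in \<open>auto simp: Y_def\<close>)
    then have "(\<lambda>m. sqrt (Y m x)) \<longlonglongrightarrow> sqrt 0"
      by (intro tendsto_real_sqrt summable_LIMSEQ_zero)
    then have "(\<lambda>m. \<bar>(\<Sum>i<(Suc m)\<^sup>2. X i x) / real ((Suc m)\<^sup>2)\<bar>) \<longlonglongrightarrow> 0"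
      unfolding Y_def real_sqrt_abs real_sqrt_zero .
    then have "(\<lambda>m. (\<Sum>i<(Suc m)\<^sup>2. X i x) / real ((Suc m)\<^sup>2)) \<longlonglongrightarrow> 0"
      by (rule tendsto_rabs_zero_cancel)
    then have "(\<lambda>m. (\<Sum>i<m\<^sup>2. X i x) / real (m\<^sup>2)) \<longlonglongrightarrow> 0"
      by (rule LIMSEQ_imp_Suc)
    then show ?case
      by (rule cesaro_null_from_squares[rotated]) (use bound elim in auto)
  qed
qed

section \<open>Bernoulli shifts\<close>

lemma distr_shift:
  assumes "prob_space N"
  shows "distr (\<Pi>\<^sub>M n\<in>UNIV. N) (\<Pi>\<^sub>M n\<in>UNIV. N) (shift n) = (\<Pi>\<^sub>M n\<in>UNIV. N)"
  using distr_PiM_reindex[of UNIV "\<lambda>_. N" "\<lambda>i. i + n" UNIV] assms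
  by (simp add: shift_def[abs_def] restrict_UNIV)

lemma measurable_shift [measurable]:
  "shift n \<in> (\<Pi>\<^sub>M n\<in>UNIV. N) \<rightarrow>\<^sub>M (\<Pi>\<^sub>M n\<in>UNIV. N)"
  unfolding shift_def
  by (rule measurable_PiM_single') (auto simp: space_PiM)

definition depends_on :: "'i set \<Rightarrow> ('i \<Rightarrow> 'a) set \<Rightarrow> (('i \<Rightarrow> 'a) \<Rightarrow> 'b) \<Rightarrow> bool" where
  "depends_on J S f \<longleftrightarrow> (\<forall>\<omega>\<in>S. \<forall>\<eta>\<in>S. (\<forall>i\<in>J. \<omega> i = \<eta> i) \<longrightarrow> f \<omega> = f \<eta>)"

lemma integral_mult_disjoint_coordinates:
  fixes f g :: "('i \<Rightarrow> 'a) \<Rightarrow> real" and N :: "'a measure"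
  defines "P \<equiv> \<Pi>\<^sub>M i\<in>UNIV. N"
  assumes N: "prob_space N" and dep: "depends_on J (space P) f" "depends_on K (space P) g" "J \<inter> K = {}"
    and int: "integrable P f" "integrable P g"
  shows "(\<integral>\<omega>. f \<omega> * g \<omega> \<partial>P) = (\<integral>\<omega>. f \<omega> \<partial>P) * (\<integral>\<omega>. g \<omega> \<partial>P)"
proof -
  interpret product_prob_space "\<lambda>_. N" "UNIV :: 'i set"
    using N by (rule product_prob_spaceI)
  have [measurable]: "f \<in> borel_measurable P" "g \<in> borel_measurable P" using int by auto
  obtain a where a: "a \<in> space N" using M.not_empty by blast
  have "P.indep_vars (\<lambda>_. N) (\<lambda>i \<omega>. \<omega> i) UNIV"
    by (subst P.indep_vars_iff_distr_eq_PiM) (auto simp: PiM_component distr_id[unfolded id_def] restrict_UNIV)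
  then have ind: "P.indep_var (PiM J (\<lambda>_. N)) (\<lambda>\<omega>. restrict \<omega> J) (PiM K (\<lambda>_. N)) (\<lambda>\<omega>. restrict \<omega> K)"
    by (rule P.indep_var_restrict) (use dep(3) in auto)
  \<comment> \<open>A function of the coordinates in \<open>I\<close> is recovered from the restriction to \<open>I\<close> by padding with \<open>a\<close>.\<close>
  define ext where "ext I v = (\<lambda>i. if i \<in> I then v i else a)" for I :: "'i set" and v
  have ext[measurable]: "ext I \<in> PiM I (\<lambda>_. N) \<rightarrow>\<^sub>M P" for I
    unfolding P_def ext_def
  proof (rule measurable_PiM_single')
    show "(\<lambda>\<omega>. if i \<in> I then \<omega> i else a) \<in> PiM I (\<lambda>_. N) \<rightarrow>\<^sub>M N" for i
      by (cases "i \<in> I") (use a in auto)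
  qed (use a in \<open>auto simp: space_PiM PiE_iff\<close>)
  have ext_eq: "h (ext I (restrict \<omega> I)) = h \<omega>"
    if "depends_on I (space P) h" "\<omega> \<in> space P" for h :: "('i \<Rightarrow> 'a) \<Rightarrow> real" and I \<omega>
  proof -
    have "ext I (restrict \<omega> I) \<in> space P"
      using that(2) a by (auto simp: P_def ext_def space_PiM PiE_iff)
    moreover have "\<forall>i\<in>I. ext I (restrict \<omega> I) i = \<omega> i" by (simp add: ext_def)
    ultimately show ?thesis using that unfolding depends_on_def by blast
  qed
  have "P.indep_var borel ((f \<circ> ext J) \<circ> (\<lambda>\<omega>. restrict \<omega> J)) borel ((g \<circ> ext K) \<circ> (\<lambda>\<omega>. restrict \<omega> K))"
    by (rule P.indep_var_compose[OF ind]) measurable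
  moreover have "integrable P ((f \<circ> ext J) \<circ> (\<lambda>\<omega>. restrict \<omega> J))"
    by (rule Bochner_Integration.integrable_cong[THEN iffD1, OF refl _ int(1)]) (simp add: ext_eq[OF dep(1)])
  moreover have "integrable P ((g \<circ> ext K) \<circ> (\<lambda>\<omega>. restrict \<omega> K))"
    by (rule Bochner_Integration.integrable_cong[THEN iffD1, OF refl _ int(2)]) (simp add: ext_eq[OF dep(2)])
  ultimately have "(\<integral>\<omega>. ((f \<circ> ext J) \<circ> (\<lambda>\<omega>. restrict \<omega> J)) \<omega> * ((g \<circ> ext K) \<circ> (\<lambda>\<omega>. restrict \<omega> K)) \<omega> \<partial>P) =
      (\<integral>\<omega>. ((f \<circ> ext J) \<circ> (\<lambda>\<omega>. restrict \<omega> J)) \<omega> \<partial>P) * (\<integral>\<omega>. ((g \<circ> ext K) \<circ> (\<lambda>\<omega>. restrict \<omega> K)) \<omega> \<partial>P)"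
    unfolding P_def by (rule P.indep_var_lebesgue_integral)
  then show ?thesis
    by (simp add: ext_eq[OF dep(1)] ext_eq[OF dep(2)] cong: Bochner_Integration.integral_cong)
qed

lemma depends_on_shift:
  assumes "depends_on J S f" "\<And>\<omega>. \<omega> \<in> S \<Longrightarrow> shift n \<omega> \<in> S"
  shows "depends_on ((\<lambda>i. i + n) ` J) S (\<lambda>\<omega>. f (shift n \<omega>))"
  using assms unfolding depends_on_def by (auto simp: shift_def)

lemma finite_ints_translate_disjoint:
  fixes J K :: "int set"
  assumes "finite J" "finite K"
  obtains L :: nat where "\<And>n. n \<ge> int L \<Longrightarrow> J \<inter> (\<lambda>i. i + n) ` K = {}"
proof -
  define b where "b = Max (insert 0 (abs ` (J \<union> K)))"
  have b: "\<bar>i\<bar> \<le> b" if "i \<in> J \<union> K" for i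
    unfolding b_def by (rule Max_ge) (use assms that in auto)
  have "J \<inter> (\<lambda>i. i + n) ` K = {}" if "n \<ge> int (nat (2 * \<bar>b\<bar> + 1))" for n
  proof (rule ccontr)
    assume "J \<inter> (\<lambda>i. i + n) ` K \<noteq> {}"
    then obtain i where "i + n \<in> J" "i \<in> K" by blast
    then have "\<bar>i + n\<bar> \<le> b" "\<bar>i\<bar> \<le> b" using b by auto
    then show False using that by linarith
  qed
  then show thesis by (rule that)
qed

lemma shift_strong_law:
  fixes f :: "(int \<Rightarrow> 'a) \<Rightarrow> real" and N :: "'a measure"
  defines "P \<equiv> \<Pi>\<^sub>M i\<in>UNIV. N"
  assumes N: "prob_space N" and J: "finite J" "depends_on J (space P) f"
    and f: "f \<in> borel_measurable P" "\<And>\<omega>. \<omega> \<in> space P \<Longrightarrow> \<bar>f \<omega>\<bar> \<le> B"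
  shows "AE \<omega> in P. (\<lambda>n. (\<Sum>j<n. f (shift (int j) \<omega>)) / real n) \<longlonglongrightarrow> (\<integral>\<omega>. f \<omega> \<partial>P)"
proof -
  interpret product_prob_space "\<lambda>_. N" "UNIV :: int set"
    using N by (rule product_prob_spaceI)
  have [measurable]: "f \<in> borel_measurable P" by fact
  have sh[measurable]: "shift n \<in> P \<rightarrow>\<^sub>M P" for n unfolding P_def by measurable
  have shP: "shift n \<omega> \<in> space P" if "\<omega> \<in> space P" for n \<omega>
    using measurable_space[OF sh that] .
  define r where "r = (\<integral>\<omega>. f \<omega> \<partial>P)"
  define X where "X j \<omega> = f (shift (int j) \<omega>) - r" for j \<omega>
  have [measurable]: "X j \<in> borel_measurable P" for j unfolding X_def by measurable
  have Xb: "\<bar>X j \<omega>\<bar> \<le> B + \<bar>r\<bar>" if "\<omega> \<in> space P" for j \<omega>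
    using f(2)[OF shP[OF that, of "int j"]] unfolding X_def by linarith
  have Xint: "integrable P (X j)" for j
    unfolding P_def using Xb by (intro P.integrable_const_bound[of _ "B + \<bar>r\<bar>"]) (auto simp: P_def[symmetric])
  have X0: "(\<integral>\<omega>. X j \<omega> \<partial>P) = 0" for j
  proof -
    have "(\<integral>\<omega>. f (shift (int j) \<omega>) \<partial>P) = (\<integral>\<omega>. f \<omega> \<partial>distr P P (shift (int j)))"
      by (rule integral_distr[symmetric]) measurable
    also have "distr P P (shift (int j)) = P" unfolding P_def by (rule distr_shift[OF N])
    finally have "(\<integral>\<omega>. f (shift (int j) \<omega>) \<partial>P) = r" by (simp add: r_def)
    moreover have "integrable P (\<lambda>\<omega>. f (shift (int j) \<omega>))"
      using f(2) shP unfolding P_def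
      by (intro P.integrable_const_bound[of _ B]) (auto simp: P_def[symmetric])
    ultimately show ?thesis
      unfolding X_def by (subst Bochner_Integration.integral_diff) (auto simp: P_def P.prob_space)
  qed
  obtain L where L: "\<And>n. n \<ge> int L \<Longrightarrow> J \<inter> (\<lambda>i. i + n) ` J = {}"
    using finite_ints_translate_disjoint[OF J(1) J(1)] by blast
  have "AE \<omega> in P. (\<lambda>n. (\<Sum>i<n. X i \<omega>) / real n) \<longlonglongrightarrow> 0"
    unfolding P_def
  proof (rule P.strong_law_finite_range; unfold P_def[symmetric])
    fix i j :: nat assume ij: "i + L \<le> j"
    have dep: "depends_on ((\<lambda>k. k + int i) ` J) (space P) (X i)" for i
      using depends_on_shift[OF J(2) shP, of "int i"] unfolding depends_on_def X_def
      by (intro ballI impI arg_cong[where f = "\<lambda>x. x - r"]) blast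
    have "(\<lambda>k. k + int i) ` J \<inter> (\<lambda>k. k + int j) ` J = {}"
    proof (rule ccontr)
      assume "(\<lambda>k. k + int i) ` J \<inter> (\<lambda>k. k + int j) ` J \<noteq> {}"
      then obtain k l where kl: "k \<in> J" "l \<in> J" "k + int i = l + int j" by blast
      then have "k = l + (int j - int i)" by linarith
      with kl have "k \<in> J \<inter> (\<lambda>k. k + (int j - int i)) ` J" by blast
      moreover have "int L \<le> int j - int i" using ij by linarith
      ultimately show False using L by blast
    qed
    from integral_mult_disjoint_coordinates[OF N dep[unfolded P_def] dep[unfolded P_def] this
        Xint[unfolded P_def] Xint[unfolded P_def]]
    show "(\<integral>\<omega>. X i \<omega> * X j \<omega> \<partial>P) = 0" unfolding P_def[symmetric] by (simp add: X0)
  qed (use Xb in auto)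
  then show ?thesis
    unfolding r_def[symmetric]
  proof eventually_elim
    case (elim \<omega>)
    have "(\<lambda>n. (\<Sum>i<n. X i \<omega>) / real n + r) \<longlonglongrightarrow> 0 + r" by (intro tendsto_intros elim)
    then have "(\<lambda>n. (\<Sum>i<n. X i \<omega>) / real n + r) \<longlonglongrightarrow> r" by simp
    then show ?case
    proof (rule Lim_transform_eventually)
      show "\<forall>\<^sub>F n in sequentially. (\<Sum>i<n. X i \<omega>) / real n + r = (\<Sum>j<n. f (shift (int j) \<omega>)) / real n"
        using eventually_gt_at_top[of 0]
        by eventually_elim (simp add: X_def sum_subtractf field_simps)
    qed
  qed
qed


section \<open>The measure on the suspension\<close>

text \<open>
  By second countability the open null sets covering the complement may be taken countable in number.
\<close>

lemma emeasure_compl_topological_support: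
  fixes M :: "'a::second_countable_topology measure"
  assumes "sets M = sets borel"
  shows "emeasure M (- topological_support M) = 0"
proof -
  define F where "F = {U :: 'a set. open U \<and> emeasure M U = 0}"
  obtain F' where F': "F' \<subseteq> F" "countable F'" "\<Union>F' = \<Union>F"
    using Lindelof[of F] unfolding F_def by blast
  have "- topological_support M = \<Union>F"
    unfolding topological_support_def F_def by (auto simp: zero_less_iff_neq_zero)
  also have "\<dots> \<in> null_sets M"
  proof -
    have "U \<in> null_sets M" if "U \<in> F'" for U
      using that F'(1) assms by (auto simp: F_def null_sets_def)
    then show ?thesis using null_sets_UN'[OF F'(2), of "\<lambda>U. U" M] F'(3) by simp
  qed
  finally show ?thesis by auto
qed

lemma measurable_PiM_borel:
  assumes "sets N = sets borel"
  shows "(\<lambda>\<omega>. \<omega>) \<in> (\<Pi>\<^sub>M i\<in>UNIV. restrict_space N A) \<rightarrow>\<^sub>M (borel :: ('i::countable \<Rightarrow> real) measure)"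
proof -
  have "(\<lambda>\<omega>. \<omega>) \<in> (\<Pi>\<^sub>M i\<in>UNIV. restrict_space N A) \<rightarrow>\<^sub>M (\<Pi>\<^sub>M (i::'i)\<in>UNIV. (borel :: real measure))"
  proof (rule measurable_PiM_single')
    fix i :: 'i
    have "(\<lambda>\<omega>. \<omega> i) \<in> (\<Pi>\<^sub>M i\<in>UNIV. restrict_space N A) \<rightarrow>\<^sub>M restrict_space N A" by measurable
    then have "(\<lambda>\<omega>. \<omega> i) \<in> (\<Pi>\<^sub>M i\<in>UNIV. restrict_space N A) \<rightarrow>\<^sub>M N"
      by (rule measurable_compose) (simp add: measurable_restrict_space1)
    then show "(\<lambda>\<omega>. \<omega> i) \<in> (\<Pi>\<^sub>M i\<in>UNIV. restrict_space N A) \<rightarrow>\<^sub>M (borel :: real measure)"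
      using measurable_cong_sets[OF refl assms] by blast
  qed auto
  then show ?thesis
    using measurable_cong_sets[OF refl sets_PiM_equal_borel] by blast
qed

locale supported_alphabet =
  fixes A :: "real set" and \<mu>0 :: "real measure"
  assumes compact: "compact A" and prob: "prob_space \<mu>0" and sets_\<mu>0: "sets \<mu>0 = sets borel"
    and support: "topological_support \<mu>0 = A"
begin

abbreviation "letters \<equiv> restrict_space \<mu>0 A"

abbreviation "shift_measure \<equiv> full_shift_measure A \<mu>0"

abbreviation "suspension_sets \<equiv>
  sigma (topspace (shift_suspension A)) {U. openin (shift_suspension A) U}"

lemma A_sets: "A \<in> sets \<mu>0"
  unfolding sets_\<mu>0 using compact by (simp add: compact_imp_closed)

lemma space_\<mu>0: "space \<mu>0 = UNIV"
  using sets_eq_imp_space_eq[OF sets_\<mu>0] by simp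

lemma space_letters: "space letters = A"
  by (simp add: space_restrict_space space_\<mu>0)

lemma prob_letters: "prob_space letters"
proof (rule prob_space_restrict_space)
  interpret prob_space \<mu>0 by (rule prob)
  have "emeasure \<mu>0 (space \<mu>0 - A) = 0"
    using emeasure_compl_topological_support[OF sets_\<mu>0] by (simp add: support space_\<mu>0 Compl_eq_Diff_UNIV)
  then have "AE x in \<mu>0. x \<in> A"
    using A_sets by (intro AE_I[of _ _ "space \<mu>0 - A"]) auto
  then show "emeasure \<mu>0 A = 1" using emeasure_eq_1_AE[OF A_sets] by simp
qed (rule A_sets)

sublocale product_prob_space "\<lambda>_. letters" "UNIV :: int set"
  using prob_letters by (rule product_prob_spaceI)

lemma space_shift_measure: "space shift_measure = sequences A"
  by (simp add: full_shift_measure_def space_PiM space_letters sequences_def PiE_UNIV_domain)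

lemma prob_shift_measure: "prob_space shift_measure"
  unfolding full_shift_measure_def by (rule P.prob_space_axioms)

lemma measurable_shift_measure_borel: "(\<lambda>\<omega>. \<omega>) \<in> shift_measure \<rightarrow>\<^sub>M borel"
  unfolding full_shift_measure_def by (rule measurable_PiM_borel[OF sets_\<mu>0])

lemma continuous_on_measurable:
  assumes "continuous_on (sequences A) (k :: (int \<Rightarrow> real) \<Rightarrow> real)"
  shows "k \<in> borel_measurable shift_measure"
proof -
  have "(\<lambda>\<omega>. \<omega>) \<in> shift_measure \<rightarrow>\<^sub>M restrict_space borel (sequences A)"
    by (rule measurable_restrict_space2[OF _ measurable_shift_measure_borel]) (simp add: space_shift_measure)
  from measurable_compose[OF this borel_measurable_continuous_on_restrict[OF assms]]
  show ?thesis .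
qed

abbreviation "unit_time \<equiv> restrict_space (lborel :: real measure) {0..1}"

lemma prob_unit_time: "prob_space unit_time"
  by (rule prob_space_restrict_space) auto

text \<open>
  The projection is continuous, but its domain carries a product \<open>\<sigma>\<close>-algebra; the two agree because
  \<open>\<int> \<rightarrow> \<real>\<close> and \<open>\<real>\<close> are second countable.
\<close>

lemma measurable_shift_proj:
  "shift_proj A \<in> shift_measure \<Otimes>\<^sub>M unit_time \<rightarrow>\<^sub>M suspension_sets"
proof (rule measurable_measure_of)
  show "{U. openin (shift_suspension A) U} \<subseteq> Pow (topspace (shift_suspension A))"
    by (auto dest: openin_subset)
  have sp: "space (shift_measure \<Otimes>\<^sub>M unit_time) = sequences A \<times> {0..1}"
    by (simp add: space_pair_measure space_shift_measure space_restrict_space)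
  then show "shift_proj A \<in> space (shift_measure \<Otimes>\<^sub>M unit_time) \<rightarrow> topspace (shift_suspension A)"
    by (auto simp: topspace_shift_suspension)
  fix U assume "U \<in> {U. openin (shift_suspension A) U}"
  then have "openin (top_of_set (sequences A \<times> UNIV)) {p \<in> sequences A \<times> UNIV. shift_proj A p \<in> U}"
    using openin_continuous_map_preimage[OF continuous_map_shift_proj] by force
  then obtain W where W: "open W" "{p \<in> sequences A \<times> UNIV. shift_proj A p \<in> U} = (sequences A \<times> UNIV) \<inter> W"
    by (auto simp: openin_open)
  have "(\<lambda>p. (fst p, snd p)) \<in> shift_measure \<Otimes>\<^sub>M unit_time \<rightarrow>\<^sub>M (borel \<Otimes>\<^sub>M borel)"
  proof (rule measurable_Pair)
    show "fst \<in> shift_measure \<Otimes>\<^sub>M unit_time \<rightarrow>\<^sub>M borel"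
      using measurable_compose[OF measurable_fst measurable_shift_measure_borel] .
    show "snd \<in> shift_measure \<Otimes>\<^sub>M unit_time \<rightarrow>\<^sub>M borel"
      by (rule measurable_compose[OF measurable_snd]) (simp add: measurable_restrict_space1)
  qed
  then have "(\<lambda>p. p) \<in> shift_measure \<Otimes>\<^sub>M unit_time \<rightarrow>\<^sub>M borel" by (simp add: borel_prod)
  from measurable_sets[OF this borel_open[OF W(1)]]
  have "W \<inter> (sequences A \<times> {0..1}) \<in> sets (shift_measure \<Otimes>\<^sub>M unit_time)" by (simp add: sp)
  moreover have "shift_proj A -` U \<inter> space (shift_measure \<Otimes>\<^sub>M unit_time) = W \<inter> (sequences A \<times> {0..1})"
    using W(2) unfolding sp by blast
  ultimately show "shift_proj A -` U \<inter> space (shift_measure \<Otimes>\<^sub>M unit_time) \<in> sets (shift_measure \<Otimes>\<^sub>M unit_time)"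
    by simp
qed

lemma suspension_measure_eq:
  "suspension_measure (full_shift_space A) full_shift shift_measure =
     distr (shift_measure \<Otimes>\<^sub>M unit_time) suspension_sets (shift_proj A)"
  by (simp add: suspension_measure_def)

lemma prob_suspension_measure:
  "prob_space (suspension_measure (full_shift_space A) full_shift shift_measure)"
  unfolding suspension_measure_eq
  by (intro prob_space.prob_space_distr measurable_shift_proj prob_space_pair prob_shift_measure prob_unit_time)

text \<open>
  Over the open unit interval the projection is injective, and it is an open map there: the preimage
  of the image is the union of all integer translates.
\<close>

lemma openin_slab:
  assumes "open W"
  shows "openin (shift_suspension A) (shift_proj A ` ((sequences A \<inter> W) \<times> {0<..<1}))"
proof -
  let ?V = "shift_proj A ` ((sequences A \<inter> W) \<times> {0<..<1})"
  have "{p \<in> sequences A \<times> UNIV. shift_proj A p \<in> ?V} =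
      (\<Union>n. (sequences A \<times> UNIV) \<inter> ((shift n -` W) \<times> {of_int n<..<of_int n + 1}))" (is "?L = ?R")
  proof (intro equalityI subsetI)
    fix p assume "p \<in> ?L"
    then obtain \<eta> s \<omega> t where p: "p = (\<eta>, s)" "\<eta> \<in> sequences A" "\<omega> \<in> W" "0 < t" "t < 1"
      "shift_proj A (\<eta>, s) = shift_proj A (\<omega>, t)" by auto
    from shift_proj_eqD[OF p(2,6)] obtain n where "\<omega> = shift n \<eta>" "s = t + of_int n" .
    then show "p \<in> ?R" using p by auto
  next
    fix p assume "p \<in> ?R"
    then obtain \<eta> s n where p: "p = (\<eta>, s)" "\<eta> \<in> sequences A" "shift n \<eta> \<in> W" "of_int n < s" "s < of_int n + 1"
      by auto
    then have "shift_proj A p = shift_proj A (shift n \<eta>, s - of_int n)"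
      using shift_proj_shift[of \<eta> A n "s - of_int n"] by simp
    then show "p \<in> ?L" using p by (auto intro!: image_eqI[of _ _ "(shift n \<eta>, s - of_int n)"])
  qed
  moreover have "openin (top_of_set (sequences A \<times> UNIV)) ?R"
    by (intro openin_Union) (auto intro!: openin_open_Int open_Times open_vimage assms continuous_on_shift)
  moreover have "?V \<subseteq> topspace (shift_suspension A)"
    unfolding topspace_shift_suspension by blast
  ultimately show ?thesis
    using quotient_map_shift_proj[unfolded quotient_map_def, THEN conjunct2, rule_format, of ?V A]
    by (simp only: topspace_euclidean_subtopology)
qed

text \<open>
  The suspension measure is an image measure, so a property of almost every \<open>\<omega>\<close> carries over once the
  corresponding set of orbits contains a measurable set of full measure. Such a set is found inside
  the open slab \<open>V\<close>, on which the base point \<open>j x\<close> is a continuous, hence measurable, function of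
  \<open>x\<close>; the section that is left out is null.
\<close>

lemma AE_suspension_measure:
  assumes "AE \<omega> in shift_measure. Q \<omega>"
  shows "AE x in suspension_measure (full_shift_space A) full_shift shift_measure.
           \<exists>\<omega>\<in>sequences A. Q \<omega> \<and> (\<exists>s. x = shift_proj A (\<omega>, s))"
proof -
  obtain N where N: "\<And>\<omega>. \<omega> \<in> space shift_measure - N \<Longrightarrow> Q \<omega>" "N \<in> null_sets shift_measure"
    using AE_E3[OF assms] by blast
  define G where "G = space shift_measure - N"
  have G: "G \<in> sets shift_measure" unfolding G_def using N(2) by auto
  define V where "V = shift_proj A ` (sequences A \<times> {0<..<1})"
  have openV: "openin (shift_suspension A) V" using openin_slab[of UNIV] by (simp add: V_def)
  have open_sets: "U \<in> sets suspension_sets" if "openin (shift_suspension A) U" for U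
    using that by (subst sets_measure_of) (auto dest: openin_subset)
  have space_susp: "space suspension_sets = topspace (shift_suspension A)"
    by (rule space_measure_of) (auto dest: openin_subset)
  have V: "V \<in> sets suspension_sets" by (rule open_sets[OF openV])
  have Vsub: "V \<subseteq> space suspension_sets" unfolding space_susp using openin_subset[OF openV] .
  \<comment> \<open>The representative with time in \<open>(0, 1)\<close> is unique, so the choice is forced on \<open>V\<close>.\<close>
  define j where "j x = (SOME \<omega>. \<omega> \<in> sequences A \<and> (\<exists>t\<in>{0<..<1}. x = shift_proj A (\<omega>, t)))" for x
  have j: "j (shift_proj A (\<omega>, t)) = \<omega>" if "\<omega> \<in> sequences A" "t \<in> {0<..<1}" for \<omega> t
    unfolding j_def
  proof (rule some_equality)
    fix \<eta> assume "\<eta> \<in> sequences A \<and> (\<exists>s\<in>{0<..<1}. shift_proj A (\<omega>, t) = shift_proj A (\<eta>, s))"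
    then obtain s where s: "s \<in> {0<..<1}" "shift_proj A (\<omega>, t) = shift_proj A (\<eta>, s)" by blast
    from shift_proj_eqD[OF that(1) s(2)] obtain n where n: "\<eta> = shift n \<omega>" "t = s + of_int n" .
    then have "n = 0" using s(1) that(2) by auto
    then show "\<eta> = \<omega>" using n by simp
  qed (use that in auto)
  have j_meas: "j \<in> restrict_space suspension_sets V \<rightarrow>\<^sub>M shift_measure"
    unfolding full_shift_measure_def
  proof (rule measurable_PiM_single')
    have spV: "space (restrict_space suspension_sets V) = V"
      using Vsub by (auto simp: space_restrict_space)
    show "j \<in> space (restrict_space suspension_sets V) \<rightarrow> (\<Pi>\<^sub>E i\<in>UNIV. space letters)"
      unfolding spV by (auto simp: V_def j space_letters sequences_iff)
    fix i :: int
    have "(\<lambda>x. j x i) \<in> borel_measurable (restrict_space suspension_sets V)"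
    proof (rule borel_measurableI)
      fix S :: "real set" assume "open S"
      then have "open ((\<lambda>\<omega> :: int \<Rightarrow> real. \<omega> i) -` S)"
        by (intro open_vimage continuous_on_product_then_coordinatewise[OF continuous_on_id])
      from open_sets[OF openin_slab[OF this]]
      have "shift_proj A ` ((sequences A \<inter> (\<lambda>\<omega>. \<omega> i) -` S) \<times> {0<..<1}) \<in> sets suspension_sets" .
      moreover have "(\<lambda>x. j x i) -` S \<inter> V = shift_proj A ` ((sequences A \<inter> (\<lambda>\<omega>. \<omega> i) -` S) \<times> {0<..<1})"
        unfolding V_def by (force simp: j)
      ultimately show "(\<lambda>x. j x i) -` S \<inter> space (restrict_space suspension_sets V) \<in> sets (restrict_space suspension_sets V)"
        unfolding spV using V Vsub by (subst sets_restrict_space_iff) auto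
    qed
    then have "(\<lambda>x. j x i) \<in> restrict_space suspension_sets V \<rightarrow>\<^sub>M \<mu>0"
      using measurable_cong_sets[OF refl sets_\<mu>0] by blast
    then show "(\<lambda>x. j x i) \<in> restrict_space suspension_sets V \<rightarrow>\<^sub>M letters"
    proof (rule measurable_restrict_space2[rotated])
      show "(\<lambda>x. j x i) \<in> space (restrict_space suspension_sets V) \<rightarrow> A"
        unfolding spV by (auto simp: V_def j sequences_iff)
    qed
  qed
  have Gset: "j -` G \<inter> V \<in> sets suspension_sets"
    using measurable_sets[OF j_meas G] V Vsub
    by (simp add: space_restrict_space sets_restrict_space_iff Int_absorb2 inf.absorb1 inf.absorb2)
  interpret PT: pair_prob_space shift_measure unit_time
    unfolding pair_prob_space_def pair_sigma_finite_def
    by (intro conjI prob_shift_measure prob_unit_time prob_space_imp_sigma_finite)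
  have "AE t in unit_time. 0 < t \<and> t < 1"
  proof (subst AE_restrict_space_iff)
    show "AE t in lborel. t \<in> {0..1::real} \<longrightarrow> 0 < t \<and> t < 1"
      using AE_lborel_singleton[of 0] AE_lborel_singleton[of 1] by eventually_elim auto
  qed simp
  moreover have "AE \<omega> in shift_measure. \<omega> \<in> G"
    using AE_not_in[OF N(2)] AE_space by eventually_elim (simp add: G_def)
  ultimately have "AE \<omega> in shift_measure. AE t in unit_time. \<omega> \<in> G \<and> 0 < t \<and> t < 1"
    by (auto elim!: eventually_mono)
  then have "AE p in shift_measure \<Otimes>\<^sub>M unit_time. fst p \<in> G \<and> 0 < snd p \<and> snd p < 1"
  proof (intro PT.AE_pair_measure)
    have [measurable]: "G \<in> sets shift_measure" "snd \<in> shift_measure \<Otimes>\<^sub>M unit_time \<rightarrow>\<^sub>M borel"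
      using G measurable_compose[OF measurable_snd, of "\<lambda>x. x" unit_time borel]
      by (auto simp: measurable_restrict_space1)
    show "{p \<in> space (shift_measure \<Otimes>\<^sub>M unit_time). fst p \<in> G \<and> 0 < snd p \<and> snd p < 1}
        \<in> sets (shift_measure \<Otimes>\<^sub>M unit_time)" by measurable
  qed simp
  then have "AE p in shift_measure \<Otimes>\<^sub>M unit_time. shift_proj A p \<in> j -` G \<inter> V"
    using AE_space
  proof eventually_elim
    case (elim p)
    obtain \<omega> t where p: "p = (\<omega>, t)" by (cases p)
    with elim have "\<omega> \<in> sequences A" "t \<in> {0<..<1}" "\<omega> \<in> G"
      by (auto simp: space_pair_measure space_shift_measure)
    then show ?case unfolding p V_def using j by auto
  qed
  moreover have "{x \<in> space suspension_sets. x \<in> j -` G \<inter> V} = j -` G \<inter> V"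
    using sets.sets_into_space[OF Gset] by blast
  ultimately have "AE x in suspension_measure (full_shift_space A) full_shift shift_measure. x \<in> j -` G \<inter> V"
    unfolding suspension_measure_eq using AE_distr_iff[OF measurable_shift_proj, of "\<lambda>x. x \<in> j -` G \<inter> V"] Gset
    by simp
  then show ?thesis
  proof eventually_elim
    case (elim x)
    then obtain \<omega> s where x: "\<omega> \<in> sequences A" "s \<in> {0<..<1}" "x = shift_proj A (\<omega>, s)"
      by (auto simp: V_def)
    then have "Q \<omega>" using elim j N(1) by (auto simp: G_def)
    then show ?case using x by blast
  qed
qed

end


section \<open>Integrals of integer-valued functions\<close>

lemma is_subring_int_algebra: "is_subring (int_algebra W)"
  unfolding int_algebra_def by (rule hull_in) (auto simp: is_subring_def)

lemma is_subring_add: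
  assumes "is_subring S" "x \<in> S" "y \<in> S"
  shows "x + y \<in> S"
proof -
  have "0 \<in> S" using assms unfolding is_subring_def by (metis diff_self)
  then have "- y \<in> S" using assms unfolding is_subring_def by (metis diff_0)
  then show ?thesis using assms unfolding is_subring_def by (metis diff_minus_eq_add)
qed

lemma is_subring_zero: "is_subring S \<Longrightarrow> 0 \<in> S"
  unfolding is_subring_def by (metis diff_self)

lemma is_subring_sum:
  assumes "is_subring S" "\<And>i. i \<in> I \<Longrightarrow> f i \<in> S"
  shows "sum f I \<in> S"
  using assms(2) by (induction I rule: infinite_finite_induct)
    (auto intro: is_subring_zero is_subring_add assms(1))

lemma is_subring_prod:
  assumes "is_subring S" "\<And>i. i \<in> I \<Longrightarrow> f i \<in> S"
  shows "prod f I \<in> S"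
  using assms(2)
proof (induction I rule: infinite_finite_induct)
  case (insert x F)
  then show ?case using assms(1) unfolding is_subring_def by auto
qed (use assms(1) in \<open>auto simp: is_subring_def\<close>)

lemma is_subring_Ints:
  assumes "is_subring S" "x \<in> \<int>"
  shows "x \<in> S"
proof -
  have one: "1 \<in> S" and zero: "0 \<in> S" using assms(1) is_subring_zero by (auto simp: is_subring_def)
  have nat: "of_nat n \<in> S" for n
    by (induction n) (auto intro: zero one is_subring_add[OF assms(1)])
  obtain m where m: "x = of_int m" using assms(2) by (auto elim: Ints_cases)
  obtain a b where "m = int a - int b" by (metis int_diff_cases)
  then have "x = of_nat a - of_nat b" using m by simp
  then show ?thesis using nat assms(1) unfolding is_subring_def by auto
qed

context supported_alphabet
begin

lemma prod_indicator_integral: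
  assumes "finite J" "\<And>i. i \<in> J \<Longrightarrow> X i \<in> sets letters"
  shows "has_bochner_integral shift_measure (\<lambda>\<omega>. \<Prod>i\<in>J. indicator (X i) (\<omega> i) :: real) (\<Prod>i\<in>J. measure letters (X i))"
proof -
  let ?E = "{\<omega> \<in> space shift_measure. \<forall>i\<in>J. \<omega> i \<in> X i}"
  have E: "emeasure shift_measure ?E = (\<Prod>i\<in>J. emeasure letters (X i))"
    unfolding full_shift_measure_def using assms by (intro emeasure_PiM_Collect) auto
  have "?E \<in> sets shift_measure"
    unfolding full_shift_measure_def using assms
    by (intro sets.sets_Collect_finite_All) (auto intro: sets_Collect_single')
  moreover have "(\<Prod>i\<in>J. emeasure letters (X i)) = ennreal (\<Prod>i\<in>J. measure letters (X i))"
    by (simp add: M.emeasure_eq_measure prod_ennreal)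
  ultimately have "has_bochner_integral shift_measure (indicator ?E) (\<Prod>i\<in>J. measure letters (X i))"
    using has_bochner_integral_real_indicator[of ?E shift_measure] E
    by (simp add: measure_def prod_nonneg)
  moreover have "(\<Prod>i\<in>J. indicator (X i) (\<omega> i) :: real) = indicator ?E \<omega>" if "\<omega> \<in> space shift_measure" for \<omega>
    using assms(1) that by (auto simp: indicator_def split: if_splits intro!: prod.neutral)
  ultimately show ?thesis by (simp cong: has_bochner_integral_cong)
qed

lemma measure_letters:
  assumes "C \<in> clop (top_of_set A)"
  shows "C \<in> sets letters" "measure letters C = measure \<mu>0 C"
proof -
  have "closed C" "C \<subseteq> A"
    using assms compact unfolding clop_def
    by (auto dest: closedin_closed_trans closedin_imp_subset simp: compact_imp_closed)
  then have "C \<in> sets \<mu>0" unfolding sets_\<mu>0 by simp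
  then show "C \<in> sets letters" "measure letters C = measure \<mu>0 C"
    using \<open>C \<subseteq> A\<close> A_sets by (auto simp: sets_restrict_space_iff measure_restrict_space space_\<mu>0)
qed

text \<open>
  The function is composed with the last map of a fine enough chain on \<open>A\<^sup>\<int>\<close>, which does not change
  it. The fibres of \<open>c\<close> are the pieces of a finite clopen partition of \<open>A\<close>.
\<close>

lemma integer_valued_coordinates:
  fixes k :: "(int \<Rightarrow> real) \<Rightarrow> real"
  assumes "continuous_on (sequences A) k" "k \<in> sequences A \<rightarrow> \<int>"
  obtains c J a where "finite J" "continuous_on A c" "c \<in> A \<rightarrow> A" "finite (c ` A)" "a \<in> A"
    "\<And>\<omega>. \<omega> \<in> sequences A \<Longrightarrow> k \<omega> = k (\<lambda>i. if i \<in> J then c (\<omega> i) else a)"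
proof -
  obtain a where a: "a \<in> A" using M.not_empty space_letters by auto
  obtain e where e: "e > 0" "\<And>c x. (id, c) \<in> (near_maps e (sequences A))\<^sup>* \<Longrightarrow> x \<in> sequences A \<Longrightarrow> k (c x) = k x"
    by (rule integer_valued_factors[OF compact_sequences[OF compact] assms]) (rule that)
  obtain c and J :: "int set" where "finite J" "continuous_on A c" "c \<in> A \<rightarrow> A" "finite (c ` A)"
    "(id, \<lambda>\<omega> i. if i \<in> J then c (\<omega> i) else a) \<in> (near_maps e (UNIV \<rightarrow> A))\<^sup>*"
    by (rule collapse_power[OF collapsible_compact_real[OF compact] a e(1)]) (rule that)
  note c = this
  have "k \<omega> = k (\<lambda>i. if i \<in> J then c (\<omega> i) else a)" if "\<omega> \<in> sequences A" for \<omega>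
    using e(2)[OF c(5)[folded sequences_def] that] by simp
  then show thesis using that[OF c(1-4) a] by blast
qed

lemma integer_valued_depends_on:
  fixes k :: "(int \<Rightarrow> real) \<Rightarrow> real"
  assumes "continuous_on (sequences A) k" "k \<in> sequences A \<rightarrow> \<int>"
  obtains J where "finite J" "depends_on J (sequences A) k"
proof -
  obtain c J a where J: "finite J" and "continuous_on A c" "c \<in> A \<rightarrow> A" "finite (c ` A)" "a \<in> A"
    and k: "\<And>\<omega>. \<omega> \<in> sequences A \<Longrightarrow> k \<omega> = k (\<lambda>i. if i \<in> J then c (\<omega> i) else a)"
    by (rule integer_valued_coordinates[OF assms]) (rule that)
  have "depends_on J (sequences A) k"
    unfolding depends_on_def
  proof (intro ballI impI)
    fix \<omega> \<eta> assume "\<omega> \<in> sequences A" "\<eta> \<in> sequences A" "\<forall>i\<in>J. \<omega> i = \<eta> i"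
    moreover from this have "(\<lambda>i. if i \<in> J then c (\<omega> i) else a) = (\<lambda>i. if i \<in> J then c (\<eta> i) else a)" by auto
    ultimately show "k \<omega> = k \<eta>" using k[of \<omega>] k[of \<eta>] by simp
  qed
  then show thesis using that J by blast
qed

lemma integrable_continuous:
  assumes "continuous_on (sequences A) (k :: (int \<Rightarrow> real) \<Rightarrow> real)"
  shows "integrable shift_measure k" "\<exists>B. \<forall>\<omega>\<in>sequences A. \<bar>k \<omega>\<bar> \<le> B"
proof -
  have "bounded (k ` sequences A)"
    by (intro compact_imp_bounded compact_continuous_image assms compact_sequences compact)
  then obtain B where B: "\<forall>x \<in> k ` sequences A. norm x \<le> B" unfolding bounded_iff by blast
  then show "\<exists>B. \<forall>\<omega>\<in>sequences A. \<bar>k \<omega>\<bar> \<le> B" by (intro exI[of _ B]) auto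
  interpret S: prob_space shift_measure by (rule prob_shift_measure)
  show "integrable shift_measure k"
  proof (rule S.integrable_const_bound[of _ B])
    show "AE \<omega> in shift_measure. norm (k \<omega>) \<le> B"
      by (rule AE_I2) (use B in \<open>simp add: space_shift_measure\<close>)
  qed (rule continuous_on_measurable[OF assms])
qed

text \<open>
  \<open>E\<close> runs over the possible values of \<open>(c(\<omega>\<^sub>i))\<close>, \<open>i \<in> J\<close>, and \<open>X v i\<close> are the clopen fibres of \<open>c\<close>. Expanding
  \<open>k\<close> over \<open>E\<close>, independence turns each integral into a product of measures of clopen sets.
\<close>

lemma integral_in_int_algebra:
  fixes k :: "(int \<Rightarrow> real) \<Rightarrow> real"
  assumes "continuous_on (sequences A) k" "k \<in> sequences A \<rightarrow> \<int>"
  shows "(\<integral>\<omega>. k \<omega> \<partial>shift_measure) \<in> int_algebra (measure \<mu>0 ` clop (top_of_set A))"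
proof -
  obtain c J a where J: "finite J" and
    c: "continuous_on A c" "c \<in> A \<rightarrow> A" "finite (c ` A)" and a: "a \<in> A" and
    k: "\<And>\<omega>. \<omega> \<in> sequences A \<Longrightarrow> k \<omega> = k (\<lambda>i. if i \<in> J then c (\<omega> i) else a)"
    by (rule integer_valued_coordinates[OF assms]) (rule that)
  let ?R = "int_algebra (measure \<mu>0 ` clop (top_of_set A))"
  define E where "E = (J \<rightarrow>\<^sub>E c ` A)"
  have finE: "finite E" unfolding E_def using J c(3) by (intro finite_PiE) auto
  define X where "X v i = {s \<in> A. c s = v i}" for v :: "int \<Rightarrow> real" and i
  have clopX: "X v i \<in> clop (top_of_set A)" for v i
  proof -
    have 1: "closedin (top_of_set A) (A \<inter> c -` W)" if "finite W" for W
      by (rule continuous_closedin_preimage[OF c(1)]) (use that in \<open>simp add: finite_imp_closed\<close>)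
    have "A - X v i = A \<inter> c -` (c ` A - {v i})" by (auto simp: X_def)
    then have "closedin (top_of_set A) (A - X v i)" using 1[of "c ` A - {v i}"] c(3) by simp
    then have "openin (top_of_set A) (X v i)"
      by (subst openin_closedin_eq) (auto simp: X_def)
    moreover have "X v i = A \<inter> c -` {v i}" by (auto simp: X_def)
    ultimately show ?thesis using 1[of "{v i}"] by (simp add: clop_def)
  qed
  define K where "K v = k (\<lambda>i. if i \<in> J then v i else a)" for v
  have K: "K v \<in> \<int>" if "v \<in> E" for v
  proof -
    have "v i \<in> A" if "i \<in> J" for i
      using PiE_mem[OF \<open>v \<in> E\<close>[unfolded E_def] that] c(2) by auto
    then show ?thesis using assms(2) a unfolding K_def by (auto simp: sequences_iff intro!: funcset_mem[OF assms(2)])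
  qed
  have k_eq: "k \<omega> = (\<Sum>v\<in>E. K v * (\<Prod>i\<in>J. indicator (X v i) (\<omega> i)))" if \<omega>: "\<omega> \<in> sequences A" for \<omega>
  proof -
    define u where "u = (\<lambda>i\<in>J. c (\<omega> i))"
    have u: "u \<in> E" using \<omega> by (auto simp: u_def E_def sequences_iff)
    have "(\<Prod>i\<in>J. indicator (X v i) (\<omega> i)) = (if v = u then 1 else 0 :: real)" if vE: "v \<in> E" for v
    proof (cases "v = u")
      case True
      then show ?thesis using \<omega> by (auto simp: X_def u_def sequences_iff intro!: prod.neutral)
    next
      case False
      then obtain i where "i \<in> J" "v i \<noteq> u i"
        using PiE_ext[OF vE[unfolded E_def] u[unfolded E_def]] by blast
      then have "\<exists>i\<in>J. indicator (X v i) (\<omega> i) = (0::real)"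
        by (intro bexI[of _ i]) (auto simp: X_def u_def indicator_def)
      then show ?thesis using J False by (simp add: prod_zero)
    qed
    then have "(\<Sum>v\<in>E. K v * (\<Prod>i\<in>J. indicator (X v i) (\<omega> i))) = (\<Sum>v\<in>E. if v = u then K v else 0)"
      by (intro sum.cong) auto
    also have "\<dots> = K u" using finE u by simp
    also have "\<dots> = k (\<lambda>i. if i \<in> J then c (\<omega> i) else a)"
      unfolding K_def by (rule arg_cong[where f = k]) (auto simp: u_def)
    finally show ?thesis using k[OF \<omega>] by simp
  qed
  have "(\<integral>\<omega>. k \<omega> \<partial>shift_measure) = (\<integral>\<omega>. (\<Sum>v\<in>E. K v * (\<Prod>i\<in>J. indicator (X v i) (\<omega> i))) \<partial>shift_measure)"
    by (rule Bochner_Integration.integral_cong) (auto simp: space_shift_measure k_eq)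
  also have "\<dots> = (\<Sum>v\<in>E. K v * (\<Prod>i\<in>J. measure letters (X v i)))"
  proof (rule has_bochner_integral_integral_eq, rule has_bochner_integral_sum, rule has_bochner_integral_mult_right)
    show "has_bochner_integral shift_measure (\<lambda>\<omega>. \<Prod>i\<in>J. indicator (X v i) (\<omega> i)) (\<Prod>i\<in>J. measure letters (X v i))" for v
      by (rule prod_indicator_integral[OF J]) (rule measure_letters(1)[OF clopX])
  qed
  also have "\<dots> \<in> ?R"
  proof (rule is_subring_sum[OF is_subring_int_algebra])
    fix v assume "v \<in> E"
    have "measure letters (X v i) \<in> ?R" for i
      unfolding measure_letters(2)[OF clopX] int_algebra_def
      by (rule hull_inc) (use clopX in blast)
    then have "(\<Prod>i\<in>J. measure letters (X v i)) \<in> ?R"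
      by (intro is_subring_prod is_subring_int_algebra)
    moreover have "K v \<in> ?R" using K[OF \<open>v \<in> E\<close>] by (rule is_subring_Ints[OF is_subring_int_algebra])
    ultimately show "K v * (\<Prod>i\<in>J. measure letters (X v i)) \<in> ?R"
      using is_subring_int_algebra[of "measure \<mu>0 ` clop (top_of_set A)"] unfolding is_subring_def by blast
  qed
  finally show ?thesis .
qed

definition integer_means :: "real set" where
  "integer_means = {\<integral>\<omega>. k \<omega> \<partial>shift_measure | k. continuous_on (sequences A) k \<and> k \<in> sequences A \<rightarrow> \<int>}"

text \<open>
  A product of integrals is the integral of \<open>f(\<omega>) g(T\<^sup>L \<omega>)\<close> for large \<open>L\<close>: the two factors are then
  independent and \<open>T\<close> preserves the measure.
\<close>

lemma is_subring_integer_means: "is_subring integer_means"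
  unfolding is_subring_def
proof (intro conjI ballI)
  interpret S: prob_space shift_measure by (rule prob_shift_measure)
  show "1 \<in> integer_means"
    unfolding integer_means_def mem_Collect_eq by (rule exI[of _ "\<lambda>_. 1"]) (auto simp: S.prob_space)
  fix x y assume "x \<in> integer_means" "y \<in> integer_means"
  then obtain f g where f: "x = (\<integral>\<omega>. f \<omega> \<partial>shift_measure)" "continuous_on (sequences A) f" "f \<in> sequences A \<rightarrow> \<int>"
    and g: "y = (\<integral>\<omega>. g \<omega> \<partial>shift_measure)" "continuous_on (sequences A) g" "g \<in> sequences A \<rightarrow> \<int>"
    unfolding integer_means_def by blast
  show "x - y \<in> integer_means"
    unfolding integer_means_def mem_Collect_eq
    by (rule exI[of _ "\<lambda>\<omega>. f \<omega> - g \<omega>"])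
      (use f g in \<open>auto simp: integrable_continuous intro!: continuous_on_diff Ints_diff\<close>)
  obtain J K where J: "finite J" "depends_on J (sequences A) f" and K: "finite K" "depends_on K (sequences A) g"
    using integer_valued_depends_on[OF f(2,3)] integer_valued_depends_on[OF g(2,3)] by metis
  obtain L where "\<And>n. n \<ge> int L \<Longrightarrow> J \<inter> (\<lambda>i. i + n) ` K = {}"
    using finite_ints_translate_disjoint[OF J(1) K(1)] by blast
  then have disj: "J \<inter> (\<lambda>i. i + int L) ` K = {}" by blast
  define h where "h \<omega> = g (shift (int L) \<omega>)" for \<omega>
  have h: "continuous_on (sequences A) h"
    unfolding h_def by (rule continuous_on_compose2[OF g(2) continuous_on_shift]) auto
  have "depends_on ((\<lambda>i. i + int L) ` K) (sequences A) h"
    unfolding h_def by (rule depends_on_shift[OF K(2)]) simp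
  from integral_mult_disjoint_coordinates[where 'i = int, OF prob_letters, folded full_shift_measure_def,
      unfolded space_shift_measure, OF J(2) this disj]
  have "(\<integral>\<omega>. f \<omega> * h \<omega> \<partial>shift_measure) = x * (\<integral>\<omega>. h \<omega> \<partial>shift_measure)"
    using f h integrable_continuous(1) by simp
  also have "(\<integral>\<omega>. h \<omega> \<partial>shift_measure) = (\<integral>\<omega>. g \<omega> \<partial>distr shift_measure shift_measure (shift (int L)))"
    unfolding h_def by (rule integral_distr[symmetric])
      (auto simp: full_shift_measure_def intro!: continuous_on_measurable[unfolded full_shift_measure_def] g)
  also have "\<dots> = y" unfolding g(1) full_shift_measure_def distr_shift[OF prob_letters] ..
  finally have "x * y = (\<integral>\<omega>. f \<omega> * h \<omega> \<partial>shift_measure)" by simp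
  moreover have "(\<lambda>\<omega>. f \<omega> * h \<omega>) \<in> sequences A \<rightarrow> \<int>"
    using f(3) g(3) by (auto simp: h_def Pi_iff intro!: Ints_mult)
  moreover have "continuous_on (sequences A) (\<lambda>\<omega>. f \<omega> * h \<omega>)" using f(2) h by (intro continuous_on_mult)
  ultimately show "x * y \<in> integer_means" unfolding integer_means_def by blast
qed

lemma integer_means_eq: "integer_means = int_algebra (measure \<mu>0 ` clop (top_of_set A))"
proof
  show "integer_means \<subseteq> int_algebra (measure \<mu>0 ` clop (top_of_set A))"
    unfolding integer_means_def using integral_in_int_algebra by blast
  have "measure \<mu>0 C \<in> integer_means" if C: "C \<in> clop (top_of_set A)" for C
  proof -
    have "continuous_on A (indicator C :: real \<Rightarrow> real)"
    proof -
      have CA: "C \<union> (A - C) = A" using C unfolding clop_def by (auto dest: closedin_imp_subset)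
      have "continuous_on (C \<union> (A - C)) (indicator C :: real \<Rightarrow> real)"
      proof (rule continuous_on_Un_local_open)
        show "openin (top_of_set (C \<union> (A - C))) C" "openin (top_of_set (C \<union> (A - C))) (A - C)"
          using C unfolding CA by (auto simp: clop_def intro!: openin_diff openin_topspace[of "top_of_set A", simplified])
        show "continuous_on C (indicator C :: real \<Rightarrow> real)"
          by (rule continuous_on_eq[OF continuous_on_const[of _ 1]]) auto
        show "continuous_on (A - C) (indicator C :: real \<Rightarrow> real)"
          by (rule continuous_on_eq[OF continuous_on_const[of _ 0]]) auto
      qed
      then show ?thesis by (rule continuous_on_subset) blast
    qed
    then have "continuous_on (sequences A) (\<lambda>\<omega>. indicator C (\<omega> 0) :: real)"
      by (rule continuous_on_compose2)
        (auto simp: sequences_iff intro: continuous_on_product_then_coordinatewise[OF continuous_on_id])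
    moreover have "(\<integral>\<omega>. indicator C (\<omega> 0) \<partial>shift_measure) = measure \<mu>0 C"
      using has_bochner_integral_integral_eq[OF prod_indicator_integral[of "{0}" "\<lambda>_. C"]] measure_letters[OF C] by simp
    ultimately show ?thesis
      unfolding integer_means_def mem_Collect_eq
      by (intro exI[of _ "\<lambda>\<omega>. indicator C (\<omega> 0)"]) (auto simp: indicator_def)
  qed
  then show "int_algebra (measure \<mu>0 ` clop (top_of_set A)) \<subseteq> integer_means"
    unfolding int_algebra_def by (intro hull_minimal is_subring_integer_means) auto
qed

end


section \<open>The Schwartzman homomorphism is a mean winding number\<close>

definition has_slope ::
    "real set \<Rightarrow> real measure \<Rightarrow> (((int \<Rightarrow> real) \<times> real) set \<Rightarrow> real set) \<Rightarrow> real \<Rightarrow> bool" where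
  "has_slope A \<mu>0 \<phi> r \<longleftrightarrow>
     (AE x in suspension_measure (full_shift_space A) full_shift (full_shift_measure A \<mu>0).
        \<exists>f. is_lift_along_orbit \<phi> x f \<and> ((\<lambda>t. f t / t) \<longlongrightarrow> r) at_top)"

context supported_alphabet
begin

lemma has_slope_mean_winding:
  assumes \<phi>: "continuous_map (shift_suspension A) circle \<phi>" and H: "box_lift A \<phi> H"
  shows "has_slope A \<mu>0 \<phi> (\<integral>\<omega>. winding H \<omega> \<partial>shift_measure)"
proof -
  have cont: "continuous_on (sequences A) (winding H)"
    using H by (intro continuous_on_winding) (simp add: box_lift_def)
  have ints: "winding H \<in> sequences A \<rightarrow> \<int>" using winding_Ints[OF H] by blast
  obtain J where J: "finite J" "depends_on J (sequences A) (winding H)"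
    using integer_valued_depends_on[OF cont ints] by blast
  obtain B where B: "\<forall>\<omega>\<in>sequences A. \<bar>winding H \<omega>\<bar> \<le> B"
    using integrable_continuous(2)[OF cont] by blast
  have "AE \<omega> in shift_measure. (\<lambda>n. (\<Sum>j<n. winding H (shift (int j) \<omega>)) / real n)
      \<longlonglongrightarrow> (\<integral>\<omega>. winding H \<omega> \<partial>shift_measure)"
    using shift_strong_law[OF prob_letters, folded full_shift_measure_def, unfolded space_shift_measure,
        OF J continuous_on_measurable[OF cont]] B by blast
  from AE_suspension_measure[OF this] show ?thesis
    unfolding has_slope_def
  proof eventually_elim
    case (elim x)
    then show ?case using lift_slope_eq_mean_winding[OF compact \<phi> H] by blast
  qed
qed

lemma has_slope_unique:
  assumes "has_slope A \<mu>0 \<phi> r" "has_slope A \<mu>0 \<phi> s"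
  shows "r = s"
proof -
  interpret S: prob_space "suspension_measure (full_shift_space A) full_shift shift_measure"
    by (rule prob_suspension_measure)
  have "AE x in suspension_measure (full_shift_space A) full_shift shift_measure. r = s"
    using assms unfolding has_slope_def by eventually_elim (blast intro: lift_slope_unique)
  then show ?thesis by simp
qed

text \<open>
  The definite description asks for one slope common to all maps in the homotopy class. A homotopy
  only provides its own pair of lifts, with equal windings, and uniqueness of the slope identifies
  their mean with that of the given lift \<open>H\<close>.
\<close>

lemma schwartzman_hom_eq_mean_winding:
  assumes \<phi>: "continuous_map (shift_suspension A) circle \<phi>" and H: "box_lift A \<phi> H"
  shows "schwartzman_hom (full_shift_space A) full_shift shift_measure
      {\<psi>. homotopic_with (\<lambda>_. True) (shift_suspension A) circle \<phi> \<psi>} =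
    (\<integral>\<omega>. winding H \<omega> \<partial>shift_measure)" (is "?hom = ?r")
proof -
  have slopes: "has_slope A \<mu>0 \<psi> ?r" if hom: "homotopic_with (\<lambda>_. True) (shift_suspension A) circle \<phi> \<psi>" for \<psi>
  proof -
    obtain G K where G: "box_lift A \<phi> G" and K: "box_lift A \<psi> K"
      and eq: "\<And>\<omega>. \<omega> \<in> sequences A \<Longrightarrow> winding G \<omega> = winding K \<omega>"
      using homotopic_box_lifts[OF compact hom] by blast
    have "?r = (\<integral>\<omega>. winding G \<omega> \<partial>shift_measure)"
      by (rule has_slope_unique[OF has_slope_mean_winding[OF \<phi> H] has_slope_mean_winding[OF \<phi> G]])
    also have "\<dots> = (\<integral>\<omega>. winding K \<omega> \<partial>shift_measure)"
      by (rule Bochner_Integration.integral_cong) (auto simp: space_shift_measure eq)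
    finally show ?thesis
      using has_slope_mean_winding[OF _ K] homotopic_with_imp_continuous_maps[OF hom] by simp
  qed
  have "?hom = (THE r. \<forall>\<psi>\<in>{\<psi>. homotopic_with (\<lambda>_. True) (shift_suspension A) circle \<phi> \<psi>}. has_slope A \<mu>0 \<psi> r)"
    unfolding schwartzman_hom_def has_slope_def ..
  also have "\<dots> = ?r"
  proof (rule the_equality)
    fix r assume "\<forall>\<psi>\<in>{\<psi>. homotopic_with (\<lambda>_. True) (shift_suspension A) circle \<phi> \<psi>}. has_slope A \<mu>0 \<psi> r"
    moreover have "homotopic_with (\<lambda>_. True) (shift_suspension A) circle \<phi> \<phi>" using \<phi> by simp
    ultimately show "r = ?r" using has_slope_unique slopes by blast
  qed (use slopes in blast)
  finally show ?thesis .
qed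

end

section \<open>Every integer-valued function is a winding function\<close>

text \<open>
  The map is \<open>\<phi>([\<omega>, t]) = t k(\<omega>)\<close> for \<open>0 \<le> t < 1\<close>, extended to all \<open>t\<close> as \<open>\<theta>\<close> by the identifications.
  The function \<open>\<theta>\<close> jumps by integers at integer times, so it is continuous only modulo \<open>\<int>\<close>. This is
  seen by comparing it, for \<open>\<bar>t\<bar> < M\<close>, with the continuous function \<open>g M\<close>, in which the term with
  index \<open>n\<close> climbs from \<open>0\<close> to \<open>k(T\<^sup>n \<omega>)\<close> during the time interval \<open>[n, n + 1]\<close>.
\<close>

lemma realize_winding:
  assumes k: "continuous_on (sequences A) k" "k \<in> sequences A \<rightarrow> \<int>"
  obtains \<phi> H where "continuous_map (shift_suspension A) circle \<phi>" "box_lift A \<phi> H" "winding H = k"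
proof -
  define \<theta> where "\<theta> p = frac (snd p) * k (shift \<lfloor>snd p\<rfloor> (fst p))" for p :: "(int \<Rightarrow> real) \<times> real"
  define \<phi> where "\<phi> x = circle_rel `` {\<theta> (SOME p. p \<in> sequences A \<times> UNIV \<and> shift_proj A p = x)}" for x
  have \<theta>_shift: "\<theta> (shift n \<omega>, t) = \<theta> (\<omega>, t + of_int n)" for n \<omega> t
    by (simp add: \<theta>_def add.commute)
  have \<phi>: "\<phi> (shift_proj A p) = circle_rel `` {\<theta> p}" if p: "p \<in> sequences A \<times> UNIV" for p
  proof -
    let ?q = "SOME q. q \<in> sequences A \<times> UNIV \<and> shift_proj A q = shift_proj A p"
    obtain \<omega> t where pt: "p = (\<omega>, t)" "\<omega> \<in> sequences A" using p by auto
    obtain \<eta> s where q: "?q = (\<eta>, s)" by (cases ?q)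
    have "?q \<in> sequences A \<times> UNIV \<and> shift_proj A ?q = shift_proj A p"
      by (rule someI[of _ p]) (use p in auto)
    then have "shift_proj A p = shift_proj A (\<eta>, s)" unfolding q by simp
    then have "shift_proj A (\<omega>, t) = shift_proj A (\<eta>, s)" unfolding pt(1) .
    from shift_proj_eqD[OF pt(2) this] obtain n where "\<eta> = shift n \<omega>" "t = s + of_int n" .
    then have "\<theta> (\<eta>, s) = \<theta> p" by (simp add: \<theta>_shift pt(1))
    then show ?thesis unfolding \<phi>_def q by (rule arg_cong)
  qed
  define g where "g M p = (\<Sum>n = - int M..int M. k (shift n (fst p)) * max 0 (min 1 (snd p - of_int n)))"
    for M :: nat and p :: "(int \<Rightarrow> real) \<times> real"
  have shift_cont: "continuous_on (sequences A \<times> UNIV) (\<lambda>p. k (shift n (fst p)))" for n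
  proof (rule continuous_on_compose2[OF k(1)])
    show "continuous_on (sequences A \<times> UNIV) (\<lambda>p. shift n (fst p))"
      by (rule continuous_on_compose2[OF continuous_on_shift[of UNIV] continuous_on_fst[OF continuous_on_id]]) simp
  qed auto
  have g_cont: "continuous_on (sequences A \<times> UNIV) (g M)" for M
    unfolding g_def by (intro continuous_intros shift_cont)
  have g_\<theta>: "circle_rel `` {g M p} = circle_rel `` {\<theta> p}"
    if p: "p \<in> sequences A \<times> UNIV" "- real M < snd p" "snd p < real M" for M p
  proof -
    obtain \<omega> t where pt: "p = (\<omega>, t)" "\<omega> \<in> sequences A" using p by auto
    define m where "m = \<lfloor>t\<rfloor>"
    have m: "m \<in> {- int M..int M}" using p(2,3) unfolding pt m_def by (simp) linarith
    have kint: "k (shift n \<omega>) \<in> \<int>" for n using k(2) pt(2) by (auto intro!: funcset_mem[OF k(2)])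
    have "k (shift n \<omega>) * max 0 (min 1 (t - of_int n)) - (if n = m then \<theta> p else 0) \<in> \<int>" for n
    proof (cases n m rule: linorder_cases)
      case less
      then have "t - of_int n \<ge> 1" unfolding m_def by linarith
      then show ?thesis using less kint[of n] by simp
    next
      case equal
      have "max 0 (min 1 (t - of_int m)) = frac t" unfolding m_def frac_def by linarith
      then show ?thesis using equal by (simp add: \<theta>_def pt m_def mult.commute)
    next
      case greater
      then have "t - of_int n \<le> 0" unfolding m_def by linarith
      then show ?thesis using greater by simp
    qed
    then have "(\<Sum>n = - int M..int M. k (shift n \<omega>) * max 0 (min 1 (t - of_int n)) - (if n = m then \<theta> p else 0)) \<in> \<int>"
      by (intro Ints_sum) auto
    then have "g M p - \<theta> p \<in> \<int>"
      unfolding sum_subtractf using m by (simp add: g_def pt)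
    then show ?thesis by (simp add: circle_class_eq)
  qed
  have "continuous_map (top_of_set (sequences A \<times> UNIV)) circle (\<lambda>p. circle_rel `` {\<theta> p})"
  proof (rule pasting_lemma[where I = UNIV and T = "\<lambda>M. sequences A \<times> {- real M<..<real M}"
        and f = "\<lambda>M p. circle_rel `` {g M p}"])
    fix M :: nat
    show "openin (top_of_set (sequences A \<times> UNIV)) (sequences A \<times> {- real M<..<real M})"
      using openin_open_Int[of "UNIV \<times> {- real M<..<real M}" "sequences A \<times> UNIV"]
      by (simp add: open_Times Times_Int_Times)
    have "continuous_map (top_of_set (sequences A \<times> {- real M<..<real M})) euclideanreal (g M)"
      using continuous_on_subset[OF g_cont] by (simp add: Times_subset_cancel2 subset_eq)
    from continuous_map_compose[OF this quotient_imp_continuous_map[OF quotient_map_quotient_topology]]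
    have "continuous_map (top_of_set (sequences A \<times> {- real M<..<real M})) circle (\<lambda>p. circle_rel `` {g M p})"
      by (simp add: o_def circle_def)
    then show "continuous_map (subtopology (top_of_set (sequences A \<times> UNIV)) (sequences A \<times> {- real M<..<real M}))
        circle (\<lambda>p. circle_rel `` {g M p})"
      by (simp add: subtopology_subtopology Times_Int_Times)
  next
    fix i j :: nat and p :: "(int \<Rightarrow> real) \<times> real"
    assume "p \<in> topspace (top_of_set (sequences A \<times> UNIV)) \<inter> (sequences A \<times> {- real i<..<real i}) \<inter> (sequences A \<times> {- real j<..<real j})"
    then have "p \<in> sequences A \<times> UNIV" "- real i < snd p" "snd p < real i" "- real j < snd p" "snd p < real j"
      by auto
    then show "circle_rel `` {g i p} = circle_rel `` {g j p}" by (simp only: g_\<theta>)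
  next
    fix p :: "(int \<Rightarrow> real) \<times> real" assume p: "p \<in> topspace (top_of_set (sequences A \<times> UNIV))"
    obtain M :: nat where "\<bar>snd p\<bar> < real M" using reals_Archimedean2 by blast
    then have "- real M < snd p" "snd p < real M" by linarith+
    then show "\<exists>M. M \<in> UNIV \<and> p \<in> sequences A \<times> {- real M<..<real M} \<and> circle_rel `` {\<theta> p} = circle_rel `` {g M p}"
      using p g_\<theta>[of p M] by (intro exI[of _ M]) auto
  qed
  then have "continuous_map (top_of_set (sequences A \<times> UNIV)) circle (\<phi> \<circ> shift_proj A)"
    by (rule continuous_map_eq) (auto simp: \<phi>)
  then have "continuous_map (shift_suspension A) circle \<phi>"
    by (rule continuous_compose_quotient_map[OF quotient_map_shift_proj])
  moreover define H where "H p = snd p * k (fst p)" for p :: "(int \<Rightarrow> real) \<times> real"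
  have "box_lift A \<phi> H"
    unfolding box_lift_def
  proof (intro conjI ballI)
    show "continuous_on (sequences A \<times> {0..1}) H"
      unfolding H_def by (intro continuous_intros continuous_on_compose2[OF k(1) continuous_on_fst]) auto
    fix p assume p: "p \<in> sequences A \<times> {0..1::real}"
    then obtain \<omega> t where pt: "p = (\<omega>, t)" "\<omega> \<in> sequences A" "0 \<le> t" "t \<le> 1" by auto
    have "H p - \<theta> p \<in> \<int>"
    proof (cases "t = 1")
      case True
      then show ?thesis using k(2) pt(2) by (auto simp: H_def \<theta>_def pt(1))
    next
      case False
      then have "\<lfloor>t\<rfloor> = 0" using pt by (simp add: floor_eq_iff)
      then show ?thesis by (simp add: H_def \<theta>_def pt(1) frac_def)
    qed
    moreover have "\<phi> (shift_proj A p) = circle_rel `` {\<theta> p}" by (rule \<phi>) (use p in auto)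
    ultimately show "circle_rel `` {H p} = \<phi> (shift_proj A p)" by (simp only: circle_class_eq)
  qed
  moreover have "winding H = k" by (simp add: fun_eq_iff winding_def H_def)
  ultimately show thesis by (rule that)
qed

section \<open>The Schwartzman group of the full shift\<close>

theorem theorem1p2:
  fixes A :: "real set" and \<mu>0 :: "real measure"
  assumes "compact A"
    and "prob_space \<mu>0"
    and "sets \<mu>0 = sets borel"
    and "topological_support \<mu>0 = A"
  shows "schwartzman_group (full_shift_space A) full_shift (full_shift_measure A \<mu>0) =
         int_algebra (measure \<mu>0 ` clop (top_of_set A))"
proof -
  interpret supported_alphabet A \<mu>0
    using assms by (rule supported_alphabet.intro)
  let ?X = "shift_suspension A"
  let ?cl = "\<lambda>\<phi>. {\<psi>. homotopic_with (\<lambda>_. True) ?X circle \<phi> \<psi>}"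
  have classes: "homotopy_classes ?X circle = ?cl ` {\<phi>. continuous_map ?X circle \<phi>}"
    unfolding homotopy_classes_def quotient_def by auto
  have "schwartzman_group (full_shift_space A) full_shift shift_measure = integer_means"
  proof (intro equalityI subsetI)
    fix r assume "r \<in> schwartzman_group (full_shift_space A) full_shift shift_measure"
    then obtain \<phi> where \<phi>: "continuous_map ?X circle \<phi>"
      and r: "r = schwartzman_hom (full_shift_space A) full_shift shift_measure (?cl \<phi>)"
      unfolding schwartzman_group_def classes by blast
    obtain H where H: "box_lift A \<phi> H" using box_lift_exists[OF compact \<phi>] .
    have "winding H \<in> sequences A \<rightarrow> \<int>" using winding_Ints[OF H] by blast
    moreover have "continuous_on (sequences A) (winding H)"
      using H by (intro continuous_on_winding) (simp add: box_lift_def)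
    ultimately show "r \<in> integer_means"
      unfolding r schwartzman_hom_eq_mean_winding[OF \<phi> H] integer_means_def mem_Collect_eq
      by (intro exI[of _ "winding H"] conjI refl)
  next
    fix r assume "r \<in> integer_means"
    then obtain k where k: "continuous_on (sequences A) k" "k \<in> sequences A \<rightarrow> \<int>"
      and r: "r = (\<integral>\<omega>. k \<omega> \<partial>shift_measure)"
      unfolding integer_means_def by blast
    obtain \<phi> H where \<phi>: "continuous_map ?X circle \<phi>" and H: "box_lift A \<phi> H" "winding H = k"
      using realize_winding[OF k] .
    have "r = schwartzman_hom (full_shift_space A) full_shift shift_measure (?cl \<phi>)"
      using schwartzman_hom_eq_mean_winding[OF \<phi> H(1)] by (simp add: r H(2))
    then show "r \<in> schwartzman_group (full_shift_space A) full_shift shift_measure"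
      unfolding schwartzman_group_def classes using \<phi> by blast
  qed
  then show ?thesis by (simp add: integer_means_eq)
qed

end
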